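(* Let $A\in\mathbb{R}^{n\times n}$, $B\in\mathbb{R}^{n\times 1}$, $C\in\mathbb{R}^{1\times n}$ define a minimal (controllable and observable) system $\dot x=Ax+Bu$, $y=Cx$. Let $F\in\mathbb{R}^{r\times r}$, $G\in\mathbb{R}^{r\times 1}$, $H\in\mathbb{R}^{1\times r}$ define a model $\dot\xi=F\xi+Gv$, $\psi=H\xi$ of order $r$. Let $S\in\mathbb{R}^{\nu\times\nu}$ be a non-derogatory matrix with characteristic polynomial $\chi_S(s)=\prod_{i=1}^{N}(s-s_i)^{k_i+1}$, where $s_1,\dots,s_N\in\mathbb{C}$ are distinct, $k_i\in\mathbb{Z}_+$ and $\nu=\sum_{i=1}^N(k_i+1)$. Let $L\in\mathbb{R}^{1\times\nu}$ be such that the pair $(S,L)$ is observable. Let $T\in\mathbb{C}^{\nu\times\nu}$ be a non-singular matrix such that $ST=TJ$ and $LT=\Lambda$, with $J=\operatorname{diag}(J_{s_1},\dots,J_{s_N})$ and $\Lambda=[\,e_1^{\mathsf T}\ \cdots\ e_1^{\mathsf T}\,]$. Assume $\sigma(S)\cap\sigma(A)=\emptyset$, and let $\Pi\in\mathbb{R}^{n\times\nu}$ be the unique solution of the Sylvester equation $A\Pi+BL=\Pi S$. Then the model $(F,G,H)$ achieves least squares moment matching at $\sigma(S)$ if and only if there exists a full rank matrix $P\in\mathbb{R}^{r\times\nu}$ such that $(F,G,H,P)$ is a solution (i.e. a minimizer) of the optimization problem $$\begin{array}{ll}\text{minimize} & \|(C\Pi-HP)T\|_{2*}^2\\ \text{subject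 to} & FP+GL=PS,\\ & \sigma(S)\cap\sigma(F)=\emptyset,\end{array}$$ in which the optimization variables are $F\in\mathbb{R}^{r\times r}$, $G\in\mathbb{R}^{r\times1}$, $H\in\mathbb{R}^{1\times r}$, $P\in\mathbb{R}^{r\times\nu}$, while $A,B,C,S,L,T$ (and hence $\Pi$) are fixed data.
   Context: Notation. $\mathbb{Z}_+$ is the set of non-negative integers and $\sigma(\cdot)$ denotes the spectrum of a matrix. $\|\cdot\|_{2*}$ is the dual norm of the Euclidean norm, so the norm of a row vector is its Euclidean (Hermitian, for complex entries) norm. A matrix is non-derogatory if its characteristic and minimal polynomials coincide. $J_{s_i}=s_iI+J_0$ is the Jordan block of size $(k_i+1)\times(k_i+1)$, where $J_0$ has ones on the superdiagonal and zeros elsewhere. In $\Lambda$, the $i$-th block $e_1^{\mathsf T}$ is the row vector of length $k_i+1$ with first entry one and all other entries zero. Moments. Let $W(s)=C(sI-A)^{-1}B$ and $\hat W(s)=H(sI-F)^{-1}G$. The moments of order $k\in\mathbb{Z}_+$ at $s^\star$ are $\eta_k(s^\star)=\frac{(-1)^k}{k!}W^{(k)}(s^\star)$ (for $s^\star\notin\sigma(A)$) and $\hat\eta_k(s^\star)=\frac{(-1)^k}{k!}\hat W^{(k)}(s^\star)$ (for $s^\star\notin\sigma(F)$). Least squares moment matching. The model $(F,G,H)$ of order $r$ achieves least squares moment matching at $\sigma(S)$ (that is, at the points $\{s_i\}_{i=1}^N$ with orders of interpolation $\{k_i\}_{i=1}^N$) if its moments at the $s_i$ are well defined (i.e. $s_i\notin\sigma(F)$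 for all $i$) and it minimizes, among systems of order $r$, the index $$\mathcal J=\sum_{i=1}^{N}\sum_{j=0}^{k_i}|\eta_j(s_i)-\hat\eta_j(s_i)|^2.$$ In this model reduction problem it is assumed that $r\in\mathbb{Z}_+$ with $2r<\nu$.
   Formalization: Added assumption: if the moments of (F,G,H) are well defined and J=0, then (F,G) is controllable; otherwise false: W=s(s²+1)/(s+1)⁴, σ(S)={0,±i}, r=1, F=−1, G=H=0 gives J=0 but forces P=0. *)

theory Defs
  imports
    "HOL-Analysis.Analysis"
    "Jordan_Normal_Form.Spectral_Radius"
    "Jordan_Normal_Form.DL_Rank"
    "Jordan_Normal_Form.Gauss_Jordan_Elimination"
begin

no_notation Finite_Cartesian_Product.vec_nth (infixl "$" 90)
no_notation Inner_Product.real_inner_class.inner (infix "\<bullet>" 70)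

text \<open>Matrices are those of the Jordan normal form library, so that all dimensions are
  natural numbers (0 included), given by \<open>carrier_mat\<close>.\<close>

abbreviation cmat :: "real mat \<Rightarrow> complex mat" where
  "cmat M \<equiv> map_mat complex_of_real M"

definition transfer_function :: "real mat \<Rightarrow> real mat \<Rightarrow> real mat \<Rightarrow> complex \<Rightarrow> complex" where
  "transfer_function A B C s =
     (cmat C * the (mat_inverse (s \<cdot>\<^sub>m 1\<^sub>m (dim_row A) - cmat A)) * cmat B) $$ (0, 0)"

text \<open>The value of \<open>transfer_function\<close> at an eigenvalue of \<open>A\<close> is unspecified; moments are only
  meaningful away from the spectrum.\<close>

definition moment :: "real mat \<Rightarrow> real mat \<Rightarrow> real mat \<Rightarrow> nat \<Rightarrow> complex \<Rightarrow> complex" where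
  "moment A B C k s = (- 1) ^ k / fact k * (deriv ^^ k) (transfer_function A B C) s"

text \<open>Kalman rank conditions, for a single input (\<open>B\<close> a column) and a single output (\<open>C\<close> a row).\<close>

definition controllable :: "real mat \<Rightarrow> real mat \<Rightarrow> bool" where
  "controllable A B \<longleftrightarrow> (let n = dim_row A in
     vec_space.rank n (mat n n (\<lambda>(i, j). (A ^\<^sub>m j * B) $$ (i, 0))) = n)"

definition observable :: "real mat \<Rightarrow> real mat \<Rightarrow> bool" where
  "observable A C \<longleftrightarrow> (let n = dim_row A in
     vec_space.rank n (mat n n (\<lambda>(i, j). (C * A ^\<^sub>m i) $$ (0, j))) = n)"

definition full_rank :: "real mat \<Rightarrow> bool" where
  "full_rank P \<longleftrightarrow> vec_space.rank (dim_row P) P = min (dim_row P) (dim_col P)"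

definition poly_mat :: "'a :: comm_ring_1 poly \<Rightarrow> 'a mat \<Rightarrow> 'a mat" where
  "poly_mat p M = mat (dim_row M) (dim_row M)
     (\<lambda>(i, j). \<Sum>l\<le>degree p. coeff p l * (M ^\<^sub>m l) $$ (i, j))"

definition is_minimal_polynomial :: "'a :: field poly \<Rightarrow> 'a mat \<Rightarrow> bool" where
  "is_minimal_polynomial p M \<longleftrightarrow>
     lead_coeff p = 1 \<and> poly_mat p M = 0\<^sub>m (dim_row M) (dim_row M) \<and>
     (\<forall>q. q \<noteq> 0 \<and> poly_mat q M = 0\<^sub>m (dim_row M) (dim_row M) \<longrightarrow> degree p \<le> degree q)"

definition non_derogatory :: "'a :: field mat \<Rightarrow> bool" where
  "non_derogatory M \<longleftrightarrow> is_minimal_polynomial (char_poly M) M"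

definition jordan_form :: "nat \<Rightarrow> (nat \<Rightarrow> complex) \<Rightarrow> (nat \<Rightarrow> nat) \<Rightarrow> complex mat" where
  "jordan_form N s k = jordan_matrix (map (\<lambda>i. (k i + 1, s i)) [0..<N])"

definition Lambda_row :: "nat \<Rightarrow> (nat \<Rightarrow> nat) \<Rightarrow> complex mat" where
  "Lambda_row N k = mat_of_rows_list (\<Sum>i<N. (k i + 1))
     [concat (map (\<lambda>i. 1 # replicate (k i) 0) [0..<N])]"

definition euclidean_norm :: "complex vec \<Rightarrow> real" where
  "euclidean_norm v = L2_set (\<lambda>j. cmod (v $ j)) {..<dim_vec v}"

text \<open>The norm of a row vector (a matrix with one row) as a functional on column vectors with
  their Euclidean norm.\<close>

definition dual_norm :: "complex mat \<Rightarrow> real" where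
  "dual_norm M =
     (SUP v \<in> {v \<in> carrier_vec (dim_col M). euclidean_norm v \<le> 1}. cmod ((M *\<^sub>v v) $ 0))"

lemma dual_norm_eq_L2_set:
  assumes M: "M \<in> carrier_mat 1 m"
  shows "dual_norm M = L2_set (\<lambda>j. cmod (M $$ (0, j))) {..<m}"
proof -
  let ?V = "{v \<in> carrier_vec m. euclidean_norm v \<le> 1}"
  let ?c = "L2_set (\<lambda>j. cmod (M $$ (0, j))) {..<m}"
  have app: "(M *\<^sub>v v) $ 0 = (\<Sum>j<m. M $$ (0, j) * v $ j)" if "v \<in> carrier_vec m" for v
    using M that by (auto simp: scalar_prod_def atLeast0LessThan intro!: sum.cong)
  have ub: "cmod ((M *\<^sub>v v) $ 0) \<le> ?c" if v: "v \<in> ?V" for v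
  proof -
    have "cmod ((M *\<^sub>v v) $ 0) \<le> (\<Sum>j<m. cmod (M $$ (0, j)) * cmod (v $ j))"
      using v by (auto simp: app norm_mult intro!: sum_norm_le)
    also have "\<dots> \<le> ?c * L2_set (\<lambda>j. cmod (v $ j)) {..<m}"
      using L2_set_mult_ineq[of "\<lambda>j. cmod (M $$ (0, j))" "\<lambda>j. cmod (v $ j)" "{..<m}"] by simp
    also have "\<dots> \<le> ?c * 1"
      using v by (intro mult_left_mono) (auto simp: euclidean_norm_def L2_set_nonneg)
    finally show ?thesis by simp
  qed
  have z: "0\<^sub>v m \<in> ?V" by (auto simp: euclidean_norm_def L2_set_def)
  have attained: "\<exists>v \<in> ?V. cmod ((M *\<^sub>v v) $ 0) = ?c"
  proof (cases "?c = 0")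
    case True
    have "cmod ((M *\<^sub>v 0\<^sub>v m) $ 0) = 0" using z by (auto simp: app)
    with True z show ?thesis by force
  next
    case False
    hence pos: "?c > 0" using L2_set_nonneg[of "\<lambda>j. cmod (M $$ (0, j))" "{..<m}"] by linarith
    define v where "v = vec m (\<lambda>j. cnj (M $$ (0, j)) / complex_of_real ?c)"
    have vc: "v \<in> carrier_vec m" by (simp add: v_def)
    have "euclidean_norm v = L2_set (\<lambda>j. (1 / ?c) * cmod (M $$ (0, j))) {..<m}"
      unfolding euclidean_norm_def using pos
      by (auto simp: v_def norm_divide intro!: L2_set_cong)
    also have "\<dots> = (1 / ?c) * ?c"
      using pos by (subst L2_set_right_distrib[symmetric]) auto
    finally have n1: "euclidean_norm v = 1" using pos by simp
    have "(M *\<^sub>v v) $ 0 = (\<Sum>j<m. complex_of_real ((cmod (M $$ (0, j)))\<^sup>2) / complex_of_real ?c)"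
      unfolding app[OF vc] by (intro sum.cong) (auto simp: v_def complex_norm_square simp del: of_real_power)
    also have "\<dots> = complex_of_real ((\<Sum>j<m. (cmod (M $$ (0, j)))\<^sup>2) / ?c)"
      by (simp add: sum_divide_distrib)
    also have "(\<Sum>j<m. (cmod (M $$ (0, j)))\<^sup>2) = ?c\<^sup>2"
      by (simp add: L2_set_def sum_nonneg)
    also have "?c\<^sup>2 / ?c = ?c" by (simp add: power2_eq_square)
    finally have "cmod ((M *\<^sub>v v) $ 0) = ?c" using pos by simp
    with vc n1 show ?thesis by (intro bexI[of _ v]) auto
  qed
  then obtain v where v: "v \<in> ?V" "cmod ((M *\<^sub>v v) $ 0) = ?c" by blast
  have dim: "dim_col M = m" using M by simp
  have "Sup ((\<lambda>v. cmod ((M *\<^sub>v v) $ 0)) ` ?V) = ?c"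
    using v ub by (intro cSup_eq_maximum) (auto simp: image_iff intro!: bexI[of _ v])
  thus ?thesis unfolding dual_norm_def dim .
qed

definition is_model :: "nat \<Rightarrow> real mat \<Rightarrow> real mat \<Rightarrow> real mat \<Rightarrow> bool" where
  "is_model r F G H \<longleftrightarrow>
     F \<in> carrier_mat r r \<and> G \<in> carrier_mat r 1 \<and> H \<in> carrier_mat 1 r"

definition matching_index ::
  "real mat \<Rightarrow> real mat \<Rightarrow> real mat \<Rightarrow> nat \<Rightarrow> (nat \<Rightarrow> complex) \<Rightarrow> (nat \<Rightarrow> nat) \<Rightarrow>
   real mat \<Rightarrow> real mat \<Rightarrow> real mat \<Rightarrow> real" where
  "matching_index A B C N s k F G H =
     (\<Sum>i<N. \<Sum>j\<le>k i. (cmod (moment A B C j (s i) - moment F G H j (s i)))\<^sup>2)"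

definition moments_well_defined :: "nat \<Rightarrow> (nat \<Rightarrow> complex) \<Rightarrow> real mat \<Rightarrow> bool" where
  "moments_well_defined N s F \<longleftrightarrow> (\<forall>i<N. s i \<notin> spectrum (cmat F))"

text \<open>The competitors are the systems of order \<open>r\<close> for which the index makes sense.\<close>

definition least_squares_moment_matching ::
  "real mat \<Rightarrow> real mat \<Rightarrow> real mat \<Rightarrow> nat \<Rightarrow> (nat \<Rightarrow> complex) \<Rightarrow> (nat \<Rightarrow> nat) \<Rightarrow>
   nat \<Rightarrow> real mat \<Rightarrow> real mat \<Rightarrow> real mat \<Rightarrow> bool" where
  "least_squares_moment_matching A B C N s k r F G H \<longleftrightarrow>
     is_model r F G H \<and> moments_well_defined N s F \<and>
     (\<forall>F' G' H'. is_model r F' G' H' \<and> moments_well_defined N s F' \<longrightarrow>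
        matching_index A B C N s k F G H \<le> matching_index A B C N s k F' G' H')"

definition feasible ::
  "real mat \<Rightarrow> real mat \<Rightarrow> nat \<Rightarrow> real mat \<Rightarrow> real mat \<Rightarrow> real mat \<Rightarrow> real mat \<Rightarrow> bool" where
  "feasible S L r F G H P \<longleftrightarrow>
     is_model r F G H \<and> P \<in> carrier_mat r (dim_row S) \<and>
     F * P + G * L = P * S \<and> spectrum (cmat S) \<inter> spectrum (cmat F) = {}"

definition objective ::
  "real mat \<Rightarrow> real mat \<Rightarrow> complex mat \<Rightarrow> real mat \<Rightarrow> real mat \<Rightarrow> real" where
  "objective C Pi_sol T H P = (dual_norm (cmat (C * Pi_sol - H * P) * T))\<^sup>2"

definition is_solution ::
  "real mat \<Rightarrow> real mat \<Rightarrow> real mat \<Rightarrow> real mat \<Rightarrow> complex mat \<Rightarrow>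
   nat \<Rightarrow> real mat \<Rightarrow> real mat \<Rightarrow> real mat \<Rightarrow> real mat \<Rightarrow> bool" where
  "is_solution C Pi_sol S L T r F G H P \<longleftrightarrow>
     feasible S L r F G H P \<and>
     (\<forall>F' G' H' P'. feasible S L r F' G' H' P' \<longrightarrow>
        objective C Pi_sol T H P \<le> objective C Pi_sol T H' P')"

end

theory Submission
  imports Defs
begin

text \<open>In the Jordan coordinates of \<open>T\<close>, the Sylvester equation \<open>F P + G L = P S\<close> says that the
  columns of \<open>P T\<close> are \<open>(-1)\<^sup>j (s\<^sub>i - F)\<^sup>-\<^sup>(\<^sup>j\<^sup>+\<^sup>1\<^sup>) G\<close>. So \<open>P\<close> exists and is unique, the entries of \<open>H P T\<close>
  are the moments of the model up to sign, and the objective is the matching index. It remains to see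
  that \<open>P\<close> has full rank at a minimizer.

  Suppose \<open>w P = 0\<close> with \<open>w \<noteq> 0\<close>. For real \<open>a\<close> outside the spectrum of \<open>S\<close> put
  \<open>p = L (S - a)\<^sup>-\<^sup>1\<close>. A rank-one update of \<open>F\<close> along \<open>w\<close> gives, for every real \<open>\<epsilon>\<close>, a model of the same order
  whose output row is \<open>H P + \<epsilon> p\<close>. Minimality then makes the error \<open>C \<Pi> - H P\<close> orthogonal to \<open>p\<close> in the
  inner product induced by \<open>T\<close>. Since \<open>(S, L)\<close> is observable, the rows \<open>p\<close> span the whole space, so
  the error vanishes. All moments are then matched, hence \<open>(F, G)\<close> is controllable, and this forces
  \<open>w = 0\<close>.\<close>

subsection \<open>Kernels, ranks and Kalman conditions\<close>

declare One_nat_def [simp del]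

lemma mult_assoc_dim:
  fixes A B C :: "'a :: semiring_0 mat"
  assumes "dim_col A = dim_row B" "dim_col B = dim_row C"
  shows "A * B * C = A * (B * C)"
  by (rule assoc_mult_mat[of A "dim_row A" "dim_col A" B "dim_col B" C "dim_col C"])
    (use assms in auto)

lemma det_zero_imp_left_kernel:
  fixes M :: "'a :: field mat"
  assumes "M \<in> carrier_mat n n" "det M = 0"
  shows "\<exists>w \<in> carrier_mat 1 n. w \<noteq> 0\<^sub>m 1 n \<and> w * M = 0\<^sub>m 1 n"
proof -
  have "det M\<^sup>T = 0" using assms det_transpose by metis
  then obtain v where v: "v \<in> carrier_vec n" "v \<noteq> 0\<^sub>v n" "M\<^sup>T *\<^sub>v v = 0\<^sub>v n"
    using det_0_iff_vec_prod_zero_field[of "M\<^sup>T" n] assms by auto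
  let ?w = "mat_of_row v"
  have "?w \<noteq> 0\<^sub>m 1 n"
  proof
    assume eq: "?w = 0\<^sub>m 1 n"
    have "v $ j = 0" if "j < n" for j
      using arg_cong[OF eq, of "\<lambda>M. M $$ (0, j)"] v that by (simp add: mat_of_row_def)
    then show False using v by auto
  qed
  moreover have "?w * M = 0\<^sub>m 1 n"
  proof (rule eq_matI)
    fix i j assume "i < dim_row (0\<^sub>m 1 n :: 'a mat)" "j < dim_col (0\<^sub>m 1 n :: 'a mat)"
    then have ij: "i = 0" "j < n" by auto
    have "(M\<^sup>T *\<^sub>v v) $ j = 0" using v ij by simp
    then have "v \<bullet> col M j = 0"
      using ij assms comm_scalar_prod[OF v(1), of "col M j"] by simp
    then show "(?w * M) $$ (i, j) = 0\<^sub>m 1 n $$ (i, j)"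
      using ij assms v(1) by simp
  qed (use assms v in auto)
  ultimately show ?thesis using v by (intro bexI[of _ ?w]) auto
qed

lemma det_zero_imp_right_kernel:
  fixes M :: "'a :: field mat"
  assumes "M \<in> carrier_mat n n" "det M = 0"
  shows "\<exists>y \<in> carrier_mat n 1. y \<noteq> 0\<^sub>m n 1 \<and> M * y = 0\<^sub>m n 1"
proof -
  have "det M\<^sup>T = 0" using assms det_transpose by metis
  then obtain w where w: "w \<in> carrier_mat 1 n" "w \<noteq> 0\<^sub>m 1 n" "w * M\<^sup>T = 0\<^sub>m 1 n"
    using det_zero_imp_left_kernel[of "M\<^sup>T" n] assms by auto
  have "M * w\<^sup>T = (w * M\<^sup>T)\<^sup>T" using w(1) assms(1) by (simp add: transpose_mult[of _ 1 n _ n])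
  also have "\<dots> = 0\<^sub>m n 1" unfolding w(3) by simp
  finally have "M * w\<^sup>T = 0\<^sub>m n 1" .
  moreover have "w\<^sup>T \<noteq> 0\<^sub>m n 1" using w(2)  by (metis Matrix.transpose_transpose zero_transpose_mat)
  ultimately show ?thesis using w by (intro bexI[of _ "w\<^sup>T"]) auto
qed

text \<open>Padding \<open>P\<close> with zero rows gives a singular square matrix, and any kernel
  vector of it is a kernel vector of \<open>P\<close>.\<close>

lemma wide_mat_kernel:
  fixes P :: "'a :: field mat"
  assumes P: "P \<in> carrier_mat r m" and "r < m"
  shows "\<exists>y \<in> carrier_mat m 1. y \<noteq> 0\<^sub>m m 1 \<and> P * y = 0\<^sub>m r 1"
proof -
  define Q where "Q = mat m m (\<lambda>(i, j). if i < r then P $$ (i, j) else 0)"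
  have Q: "Q \<in> carrier_mat m m" by (simp add: Q_def)
  \<comment> \<open>Row \<open>r\<close> of \<open>Q\<close> is the first padded row. It exists
    because \<open>r < m\<close>, and it makes the determinant vanish.\<close>
  have "Q = mat\<^sub>r m m (\<lambda>i. if i = r then 0\<^sub>v m else row Q i)"
    using assms by (intro eq_matI) (auto simp: Q_def)
  moreover have "row Q \<in> {0..<m} \<rightarrow> carrier_vec m" using Q by auto
  ultimately have "det Q = 0" using det_row_0[of r m "row Q"] \<open>r < m\<close> by metis
  then obtain y where y: "y \<in> carrier_mat m 1" "y \<noteq> 0\<^sub>m m 1" "Q * y = 0\<^sub>m m 1"
    using det_zero_imp_right_kernel[OF Q] by blast
  have "P * y = 0\<^sub>m r 1"
  proof (rule eq_matI)
    fix i j assume "i < dim_row (0\<^sub>m r 1 :: 'a mat)" "j < dim_col (0\<^sub>m r 1 :: 'a mat)"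
    then have ij: "i < r" "j = 0" by auto
    have "row Q i = row P i" using ij assms by (intro eq_vecI) (auto simp: Q_def)
    moreover have "(Q * y) $$ (i, 0) = 0" unfolding y(3) using ij assms by simp
    then have "row Q i \<bullet> col y 0 = 0" using y(1) Q ij assms by simp
    ultimately show "(P * y) $$ (i, j) = 0\<^sub>m r 1 $$ (i, j)"
      using ij assms y(1) by simp
  qed (use y P in auto)
  with y show ?thesis by blast
qed

lemma rank_right_inverse:
  fixes P :: "'a :: field mat"
  assumes P: "P \<in> carrier_mat r m" and Q: "Q \<in> carrier_mat m r" and PQ: "P * Q = 1\<^sub>m r"
  shows "vec_space.rank r P = r"
proof -
  interpret vec_space "TYPE('a)" r .
  have "v \<in> span (set (cols P))" if v: "v \<in> carrier_vec r" for v
  proof -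
    have "v = P *\<^sub>v (Q *\<^sub>v v)" using v P Q PQ by (metis assoc_mult_mat_vec one_mult_mat_vec)
    moreover have "Q *\<^sub>v v \<in> carrier_vec m" using Q v by simp
    ultimately show ?thesis using col_space_eq[OF P] unfolding col_space_def
      using P v by (auto intro!: bexI[of _ "Q *\<^sub>v v"])
  qed
  moreover have "span (set (cols P)) \<subseteq> carrier_vec r"
    using P cols_dim[of P] span_is_subset2 by auto
  ultimately have "span (set (cols P)) = carrier_vec r" by auto
  then have "span_vs (set (cols P)) = V" by (simp add: module_vec_def)
  then show ?thesis using dim_is_n unfolding rank_def by simp
qed

lemma row_times_transpose:
  fixes x :: "real mat"
  assumes "x \<in> carrier_mat 1 m"
  shows "(x * x\<^sup>T) $$ (0, 0) = (\<Sum>j<m. (x $$ (0, j))\<^sup>2)"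
proof -
  have "(x * x\<^sup>T) $$ (0, 0) = row x 0 \<bullet> row x 0" using assms by simp
  also have "\<dots> = (\<Sum>j\<in>{0..<m}. row x 0 $ j * row x 0 $ j)"
    using assms by (simp add: scalar_prod_def)
  also have "\<dots> = (\<Sum>j<m. (x $$ (0, j))\<^sup>2)"
    unfolding atLeast0LessThan using assms by (intro sum.cong) (auto simp: power2_eq_square)
  finally show ?thesis .
qed

text \<open>Over the reals the Gram matrix \<open>P * P\<^sup>T\<close> decides the matter. If it is
  invertible, \<open>P\<close> has a right inverse and hence full rank. If it is singular, a row
  \<open>w\<close> in its left kernel satisfies \<open>w P P\<^sup>T w\<^sup>T = 0\<close>; this is
  a sum of squares, so \<open>w P = 0\<close>.\<close>

lemma not_full_rank_imp_left_kernel: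
  assumes P: "P \<in> carrier_mat r m" and rm: "r \<le> m" and not_full: "\<not> full_rank P"
  shows "\<exists>w \<in> carrier_mat 1 r. w \<noteq> 0\<^sub>m 1 r \<and> w * P = 0\<^sub>m 1 m"
proof -
  let ?M = "P * P\<^sup>T"
  have M: "?M \<in> carrier_mat r r" using P by simp
  show ?thesis
  proof (cases "det ?M = 0")
    case False
    then obtain N where N: "N \<in> carrier_mat r r" "?M * N = 1\<^sub>m r"
      using det_non_zero_imp_unit[OF M False, of "()"]
      by (auto simp: Units_def ring_mat_def)
    then have "P * (P\<^sup>T * N) = 1\<^sub>m r" using P by (simp add: mult_assoc_dim)
    then have "vec_space.rank r P = r"
      using rank_right_inverse[of P r m "P\<^sup>T * N"] P N by auto
    then show ?thesis using not_full P rm by (simp add: full_rank_def)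
  next
    case True
    then obtain w where w: "w \<in> carrier_mat 1 r" "w \<noteq> 0\<^sub>m 1 r" "w * ?M = 0\<^sub>m 1 r"
      using det_zero_imp_left_kernel[OF M] by blast
    let ?x = "w * P"
    have "?x * ?x\<^sup>T = w * ?M * w\<^sup>T"
      using w(1) P by (simp add: transpose_mult[of _ 1 r _ m] mult_assoc_dim)
    also have "\<dots> = 0\<^sub>m 1 1" unfolding w(3) using w(1) by simp
    finally have "(?x * ?x\<^sup>T) $$ (0, 0) = 0" by simp
    then have "(\<Sum>j<m. (?x $$ (0, j))\<^sup>2) = 0"
      using row_times_transpose[of ?x m] w P by simp
    then have "\<forall>j<m. ?x $$ (0, j) = 0"
      by (subst (asm) sum_nonneg_eq_0_iff) auto
    then have "?x = 0\<^sub>m 1 m" using w P by (intro eq_matI) (auto simp del: index_mult_mat(1))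
    with w show ?thesis by blast
  qed
qed

section \<open>Kalman rank conditions as statements about kernels\<close>

lemma observableD:
  assumes S: "S \<in> carrier_mat m m" and L: "L \<in> carrier_mat 1 m" and obs: "observable S L"
    and y: "y \<in> carrier_mat m 1" and ortho: "\<And>i. i < m \<Longrightarrow> L * S ^\<^sub>m i * y = 0\<^sub>m 1 1"
  shows "y = 0\<^sub>m m 1"
proof -
  define O1 where "O1 = mat m m (\<lambda>(i, j). (L * S ^\<^sub>m i) $$ (0, j))"
  have O1: "O1 \<in> carrier_mat m m" by (simp add: O1_def)
  have det: "det O1 \<noteq> 0"
    using obs S vec_space.det_rank_iff[OF O1] by (simp add: observable_def O1_def Let_def)
  have "O1 * y = 0\<^sub>m m 1"
  proof (rule eq_matI)
    fix i j assume "i < dim_row (0\<^sub>m m 1 :: real mat)" "j < dim_col (0\<^sub>m m 1 :: real mat)"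
    then have ij: "i < m" "j = 0" by auto
    have "row O1 i = row (L * S ^\<^sub>m i) 0" using ij carrier_matD(2)[OF pow_carrier_mat[OF S, of i]] L by (intro eq_vecI) (simp_all add: O1_def del: index_mult_mat(1))
    moreover have "(L * S ^\<^sub>m i * y) $$ (0, 0) = 0" using ortho[OF ij(1)] by simp
    ultimately show "(O1 * y) $$ (i, j) = 0\<^sub>m m 1 $$ (i, j)"
      using ij O1 y L S by simp
  qed (use O1 y in auto)
  moreover obtain N where N: "N \<in> carrier_mat m m" "N * O1 = 1\<^sub>m m"
    using det_non_zero_imp_unit[OF O1 det, of "()"] by (auto simp: Units_def ring_mat_def)
  moreover have "N * O1 * y = N * (O1 * y)" using N O1 y by (intro mult_assoc_dim) auto
  ultimately show ?thesis using y by simp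
qed

lemma controllableD:
  assumes F: "F \<in> carrier_mat m m" and G: "G \<in> carrier_mat m 1" and ctr: "controllable F G"
    and w: "w \<in> carrier_mat 1 m" and ortho: "\<And>i. i < m \<Longrightarrow> w * (F ^\<^sub>m i * G) = 0\<^sub>m 1 1"
  shows "w = 0\<^sub>m 1 m"
proof -
  define R where "R = mat m m (\<lambda>(i, j). (F ^\<^sub>m j * G) $$ (i, 0))"
  have R: "R \<in> carrier_mat m m" by (simp add: R_def)
  have det: "det R \<noteq> 0"
    using ctr F vec_space.det_rank_iff[OF R] by (simp add: controllable_def R_def Let_def)
  have wR: "w * R = 0\<^sub>m 1 m"
  proof (rule eq_matI)
    fix i j assume "i < dim_row (0\<^sub>m 1 m :: real mat)" "j < dim_col (0\<^sub>m 1 m :: real mat)"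
    then have ij: "i = 0" "j < m" by auto
    have "col R j = col (F ^\<^sub>m j * G) 0" using ij F G by (intro eq_vecI) (simp_all add: R_def del: index_mult_mat(1))
    moreover have "(w * (F ^\<^sub>m j * G)) $$ (0, 0) = 0" using ortho[OF ij(2)] by simp
    ultimately show "(w * R) $$ (i, j) = 0\<^sub>m 1 m $$ (i, j)"
      using ij R w F G by simp
  qed (use R w in auto)
  obtain N where N: "N \<in> carrier_mat m m" "R * N = 1\<^sub>m m"
    using det_non_zero_imp_unit[OF R det, of "()"] by (auto simp: Units_def ring_mat_def)
  have "w = w * R * N" using w R N by (simp add: mult_assoc_dim)
  also have "\<dots> = 0\<^sub>m 1 m" unfolding wR using N by simp
  finally show ?thesis .
qed

subsection \<open>Resolvents and moments\<close>

lemma sum_mat_mult: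
  assumes "A \<in> carrier_mat n m" "B \<in> carrier_mat m l" "i < n" "j < l"
  shows "(A * B) $$ (i, j) = (\<Sum>k<m. A $$ (i, k) * B $$ (k, j))"
  using assms by (auto simp: scalar_prod_def atLeast0LessThan intro!: sum.cong)

text \<open>The adjugate formula for \<open>(z - M)\<^sup>-\<^sup>1\<close>. Its entries are visibly
  rational functions of \<open>z\<close>, which gives continuity at once. At an eigenvalue the
  inverse of 0 makes it the zero matrix, so it is defined for every \<open>z\<close>.\<close>

definition resolvent :: "'a :: field mat \<Rightarrow> 'a \<Rightarrow> 'a mat" where
  "resolvent M z = inverse (poly (char_poly M) z) \<cdot>\<^sub>m
     map_mat (\<lambda>p. poly p z) (adj_mat (char_poly_matrix M))"

lemma resolvent_carrier [simp]: "M \<in> carrier_mat n n \<Longrightarrow> resolvent M z \<in> carrier_mat n n"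
  by (auto simp: resolvent_def adj_mat_def char_poly_matrix_def)

lemma spectrum_iff_root:
  fixes M :: "'a :: field mat"
  assumes "M \<in> carrier_mat n n"
  shows "z \<in> spectrum M \<longleftrightarrow> poly (char_poly M) z = 0"
  using eigenvalue_root_char_poly[OF assms] by (simp add: spectrum_def)

text \<open>Evaluation of polynomials at \<open>z\<close> is a ring homomorphism, so it carries the
  adjugate identities of \<open>char_poly_matrix M\<close> over to \<open>z - M\<close>. The
  determinant becomes a scalar that is nonzero off the spectrum.\<close>

lemma resolvent:
  fixes M :: "'a :: field mat"
  assumes M: "M \<in> carrier_mat n n" and z: "z \<notin> spectrum M"
  shows resolvent_right: "(z \<cdot>\<^sub>m 1\<^sub>m n - M) * resolvent M z = 1\<^sub>m n"
    and resolvent_left: "resolvent M z * (z \<cdot>\<^sub>m 1\<^sub>m n - M) = 1\<^sub>m n"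
proof -
  let ?X = "char_poly_matrix M" and ?Y = "adj_mat (char_poly_matrix M)"
  let ?e = "map_mat (\<lambda>p. poly p z)"
  have c: "?X \<in> carrier_mat n n" "?Y \<in> carrier_mat n n" using M adj_mat(1)[of ?X n] by auto
  have e: "?e ?X = z \<cdot>\<^sub>m 1\<^sub>m n - M"
    using M by (intro eq_matI) (auto simp: char_poly_matrix_def)
  have nz: "poly (char_poly M) z \<noteq> 0" using z spectrum_iff_root[OF M] by simp
  have "?e ?X * ?e ?Y = ?e (?X * ?Y)" "?e ?Y * ?e ?X = ?e (?Y * ?X)"
    using semiring_hom.mat_hom_mult[OF poly_hom.semiring_hom_axioms c, of z]
      semiring_hom.mat_hom_mult[OF poly_hom.semiring_hom_axioms c(2,1), of z] by auto
  moreover have "?e (?X * ?Y) = poly (char_poly M) z \<cdot>\<^sub>m 1\<^sub>m n"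
    "?e (?Y * ?X) = poly (char_poly M) z \<cdot>\<^sub>m 1\<^sub>m n"
    using adj_mat(2,3)[OF c(1)] by (auto simp: char_poly_def intro!: eq_matI)
  moreover have "?e ?Y \<in> carrier_mat n n" "z \<cdot>\<^sub>m 1\<^sub>m n - M \<in> carrier_mat n n" using c M by auto
  moreover have "inverse (poly (char_poly M) z) \<cdot>\<^sub>m (poly (char_poly M) z \<cdot>\<^sub>m 1\<^sub>m n) = 1\<^sub>m n"
    using nz by (intro eq_matI) auto
  ultimately show "(z \<cdot>\<^sub>m 1\<^sub>m n - M) * resolvent M z = 1\<^sub>m n"
    "resolvent M z * (z \<cdot>\<^sub>m 1\<^sub>m n - M) = 1\<^sub>m n"
    unfolding resolvent_def e
    by (simp_all add: mult_smult_distrib[of _ n n _ n] mult_smult_assoc_mat[of _ n n _ n])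
qed

lemma resolvent_unique:
  fixes M :: "'a :: field mat"
  assumes M: "M \<in> carrier_mat n n" and z: "z \<notin> spectrum M"
    and X: "X \<in> carrier_mat n n" "(z \<cdot>\<^sub>m 1\<^sub>m n - M) * X = 1\<^sub>m n"
  shows "X = resolvent M z"
proof -
  let ?Z = "z \<cdot>\<^sub>m 1\<^sub>m n - M"
  have Z: "?Z \<in> carrier_mat n n" using M by auto
  have "resolvent M z * (?Z * X) = resolvent M z * ?Z * X"
    by (rule assoc_mult_mat[OF resolvent_carrier[OF M] Z X(1), symmetric])
  then show ?thesis using X M by (simp add: resolvent_left[OF M z] right_mult_one_mat[OF resolvent_carrier[OF M]])
qed

lemma mat_inverse_eq_resolvent:
  fixes M :: "'a :: field mat"
  assumes M: "M \<in> carrier_mat n n" and z: "z \<notin> spectrum M"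
  shows "the (mat_inverse (z \<cdot>\<^sub>m 1\<^sub>m n - M)) = resolvent M z"
proof -
  let ?Z = "z \<cdot>\<^sub>m 1\<^sub>m n - M"
  have Z: "?Z \<in> carrier_mat n n" using M by auto
  have "?Z \<in> Units (ring_mat TYPE('a) n ())"
    using Z M resolvent[OF M z]
    by (auto simp: Units_def ring_mat_def intro!: bexI[of _ "resolvent M z"])
  then obtain X where X: "mat_inverse ?Z = Some X"
    using mat_inverse(1)[OF Z, of "()"] by (cases "mat_inverse ?Z") auto
  then show ?thesis
    using mat_inverse(2)[OF Z X] resolvent_unique[OF M z, of X] by simp
qed

lemma open_compl_spectrum:
  fixes M :: "complex mat"
  assumes "M \<in> carrier_mat n n"
  shows "open (- spectrum M)"
  using card_finite_spectrum(1)[OF assms] finite_imp_closed by auto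

section \<open>Derivatives of the resolvent and of the transfer function\<close>

lemma resolvent_identity:
  fixes M :: "'a :: field mat"
  assumes M: "M \<in> carrier_mat n n" and z: "z \<notin> spectrum M" and t: "t \<notin> spectrum M"
  shows "resolvent M t - resolvent M z = (z - t) \<cdot>\<^sub>m (resolvent M t * resolvent M z)"
proof -
  let ?Rt = "resolvent M t" and ?Rz = "resolvent M z"
  let ?Zt = "t \<cdot>\<^sub>m 1\<^sub>m n - M" and ?Zz = "z \<cdot>\<^sub>m 1\<^sub>m n - M"
  have c: "?Rt \<in> carrier_mat n n" "?Rz \<in> carrier_mat n n"
    "?Zt \<in> carrier_mat n n" "?Zz \<in> carrier_mat n n" using M by auto
  have "?Rt - ?Rz = ?Rt * (?Zz * ?Rz) - ?Rt * ?Zt * ?Rz"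
    using c by (simp add: resolvent_right[OF M z] resolvent_left[OF M t])
  also have "\<dots> = ?Rt * (?Zz * ?Rz) - ?Rt * (?Zt * ?Rz)"
    using assoc_mult_mat[OF c(1,3,2)] by simp
  also have "\<dots> = ?Rt * ((?Zz - ?Zt) * ?Rz)"
    using c by (subst mult_minus_distrib_mat[of _ n n _ n, symmetric])
      (auto simp: minus_mult_distrib_mat[of _ n n _ _ n])
  also have "?Zz - ?Zt = (z - t) \<cdot>\<^sub>m 1\<^sub>m n"
    using M by (intro eq_matI) (auto simp: algebra_simps)
  finally show ?thesis using c
    by (simp add: mult_smult_distrib[of _ n n _ n] mult_smult_assoc_mat[of _ n n _ n])
qed

text \<open>Differentiability is taken entrywise, with explicit dimensions because matrices of all
  sizes share one type.\<close>

definition has_mat_derivative ::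
  "nat \<Rightarrow> nat \<Rightarrow> (complex \<Rightarrow> complex mat) \<Rightarrow> complex mat \<Rightarrow> complex \<Rightarrow> bool" where
  "has_mat_derivative n m f D z \<longleftrightarrow> (\<forall>t. f t \<in> carrier_mat n m) \<and> D \<in> carrier_mat n m \<and>
     (\<forall>i<n. \<forall>j<m. ((\<lambda>t. f t $$ (i, j)) has_field_derivative D $$ (i, j)) (at z))"

lemma has_mat_derivative_mult:
  assumes f: "has_mat_derivative n m f D z" and g: "has_mat_derivative m l g E z"
  shows "has_mat_derivative n l (\<lambda>t. f t * g t) (D * g z + f z * E) z"
proof -
  have c: "f z \<in> carrier_mat n m" "g z \<in> carrier_mat m l" "D \<in> carrier_mat n m"
    "E \<in> carrier_mat m l" and fg: "f t \<in> carrier_mat n m" "g t \<in> carrier_mat m l" for t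
    using f g by (auto simp: has_mat_derivative_def)
  have "((\<lambda>t. (f t * g t) $$ (i, j)) has_field_derivative (D * g z + f z * E) $$ (i, j)) (at z)"
    if ij: "i < n" "j < l" for i j
  proof -
    have "((\<lambda>t. \<Sum>k<m. f t $$ (i, k) * g t $$ (k, j)) has_field_derivative
        (\<Sum>k<m. D $$ (i, k) * g z $$ (k, j) + E $$ (k, j) * f z $$ (i, k))) (at z)"
      using f g ij by (intro DERIV_sum DERIV_mult) (auto simp: has_mat_derivative_def)
    moreover have "(D * g z + f z * E) $$ (i, j) =
        (\<Sum>k<m. D $$ (i, k) * g z $$ (k, j) + E $$ (k, j) * f z $$ (i, k))"
      using ij c sum_mat_mult[OF c(3,2) ij] sum_mat_mult[OF c(1,4) ij]
      by (simp add: sum.distrib mult.commute del: index_mult_mat(1))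
    ultimately show ?thesis using sum_mat_mult[OF fg ij] by simp
  qed
  moreover have "f t * g t \<in> carrier_mat n l" for t by (rule mult_carrier_mat[OF fg])
  moreover have "D * g z + f z * E \<in> carrier_mat n l" using c by (metis add_carrier_mat mult_carrier_mat)
  ultimately show ?thesis unfolding has_mat_derivative_def by blast
qed

lemma has_mat_derivative_const:
  "A \<in> carrier_mat n m \<Longrightarrow> has_mat_derivative n m (\<lambda>t. A) (0\<^sub>m n m) z"
  by (simp add: has_mat_derivative_def)

text \<open>By the resolvent identity the difference quotient at \<open>z\<close> is
  \<open>- R t R z\<close>, where \<open>R\<close> is the resolvent. Continuity of the entries gives
  the limit.\<close>

lemma has_mat_derivative_resolvent:
  assumes M: "M \<in> carrier_mat n n" and z: "z \<notin> spectrum M"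
  shows "has_mat_derivative n n (resolvent M) ((- 1) \<cdot>\<^sub>m (resolvent M z * resolvent M z)) z"
proof -
  let ?R = "resolvent M"
  have R: "?R t \<in> carrier_mat n n" for t using M by simp
  have nz: "poly (char_poly M) z \<noteq> 0" using z spectrum_iff_root[OF M] by simp
  have lim: "((\<lambda>t. ?R t $$ (i, j)) \<longlongrightarrow> ?R z $$ (i, j)) (at z)" if "i < n" "j < n" for i j
  proof -
    have dims: "adj_mat (char_poly_matrix M) \<in> carrier_mat n n"
      using M adj_mat(1)[of "char_poly_matrix M" n] by auto
    have "((\<lambda>t. inverse (poly (char_poly M) t) * poly (adj_mat (char_poly_matrix M) $$ (i, j)) t)
        \<longlongrightarrow> inverse (poly (char_poly M) z) * poly (adj_mat (char_poly_matrix M) $$ (i, j)) z) (at z)"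
      using nz by (intro tendsto_intros) auto
    then show ?thesis using dims that by (simp add: resolvent_def)
  qed
  have "((\<lambda>t. ?R t $$ (i, j)) has_field_derivative ((- 1) \<cdot>\<^sub>m (?R z * ?R z)) $$ (i, j)) (at z)"
    if ij: "i < n" "j < n" for i j
    unfolding has_field_derivative_iff
  proof (rule Lim_transform_eventually)
    have "((\<lambda>t. - (\<Sum>k<n. ?R t $$ (i, k) * ?R z $$ (k, j))) \<longlongrightarrow>
        - (\<Sum>k<n. ?R z $$ (i, k) * ?R z $$ (k, j))) (at z)"
      using ij by (intro tendsto_intros lim) auto
    then show "((\<lambda>t. - (\<Sum>k<n. ?R t $$ (i, k) * ?R z $$ (k, j))) \<longlongrightarrow>
        ((- 1) \<cdot>\<^sub>m (?R z * ?R z)) $$ (i, j)) (at z)"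
      using ij R[of z] sum_mat_mult[OF R[of z] R[of z] ij] by (simp del: index_mult_mat(1))
  next
    \<comment> \<open>The resolvent identity needs \<open>t\<close> off the spectrum. The complement
      of the spectrum is open, so this holds for all \<open>t\<close> near \<open>z\<close>.\<close>
    have "eventually (\<lambda>t. t \<in> - spectrum M \<and> t \<noteq> z) (at z)"
      using eventually_at_in_open[OF open_compl_spectrum[OF M], of z] z by auto
    then show "\<forall>\<^sub>F t in at z. - (\<Sum>k<n. ?R t $$ (i, k) * ?R z $$ (k, j)) =
        (?R t $$ (i, j) - ?R z $$ (i, j)) / (t - z)"
    proof eventually_elim
      case (elim t)
      have "?R t $$ (i, j) - ?R z $$ (i, j) = (?R t - ?R z) $$ (i, j)"
        using R[of t] R[of z] ij by simp
      also have "\<dots> = (z - t) * (?R t * ?R z) $$ (i, j)"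
        using resolvent_identity[OF M z, of t] elim R[of t] R[of z] ij by simp
      also have "(?R t * ?R z) $$ (i, j) = (\<Sum>k<n. ?R t $$ (i, k) * ?R z $$ (k, j))"
        by (rule sum_mat_mult[OF R R ij])
      finally show ?case using elim by (simp add: field_simps)
    qed
  qed
  moreover have "(- 1) \<cdot>\<^sub>m (?R z * ?R z) \<in> carrier_mat n n"
    by (rule smult_carrier_mat[OF mult_carrier_mat[OF R R]])
  ultimately show ?thesis using R by (auto simp: has_mat_derivative_def)
qed

lemma pow_mat_commute_self:
  "R \<in> carrier_mat n n \<Longrightarrow> R * R ^\<^sub>m j = R ^\<^sub>m j * R"
  by (induction j) (auto simp: assoc_mult_mat[of _ n n _ n _ n, symmetric])

lemma has_mat_derivative_resolvent_pow:
  assumes M: "M \<in> carrier_mat n n" and z: "z \<notin> spectrum M"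
  shows "has_mat_derivative n n (\<lambda>t. resolvent M t ^\<^sub>m j)
    ((- of_nat j) \<cdot>\<^sub>m resolvent M z ^\<^sub>m Suc j) z"
proof (induction j)
  case 0
  have "(0 :: complex) \<cdot>\<^sub>m resolvent M z = 0\<^sub>m n n" using resolvent_carrier[OF M, of z] by (intro eq_matI) auto
  moreover have "dim_row (resolvent M t) = n" for t using resolvent_carrier[OF M] by blast
  ultimately show ?case using M has_mat_derivative_const[of "1\<^sub>m n" n n z] by simp
next
  case (Suc j)
  let ?R = "resolvent M z"
  have R: "?R \<in> carrier_mat n n" "?R ^\<^sub>m j \<in> carrier_mat n n" using M by auto
  have "has_mat_derivative n n (\<lambda>t. resolvent M t ^\<^sub>m j * resolvent M t)
    (((- of_nat j) \<cdot>\<^sub>m ?R ^\<^sub>m Suc j) * ?R + ?R ^\<^sub>m j * ((- 1) \<cdot>\<^sub>m (?R * ?R))) z"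
    by (rule has_mat_derivative_mult[OF Suc has_mat_derivative_resolvent[OF M z]])
  also have "((- of_nat j) \<cdot>\<^sub>m ?R ^\<^sub>m Suc j) * ?R + ?R ^\<^sub>m j * ((- 1) \<cdot>\<^sub>m (?R * ?R)) =
      (- of_nat j) \<cdot>\<^sub>m ?R ^\<^sub>m Suc (Suc j) + (- 1) \<cdot>\<^sub>m ?R ^\<^sub>m Suc (Suc j)"
    using R mult_smult_distrib[OF R(2) mult_carrier_mat[OF R(1) R(1)], of "- 1"]
      mult_smult_assoc_mat[OF mult_carrier_mat[OF R(2) R(1)] R(1), of "- of_nat j"]
      assoc_mult_mat[OF R(2) R(1) R(1)] by simp
  also have "\<dots> = (- of_nat (Suc j)) \<cdot>\<^sub>m ?R ^\<^sub>m Suc (Suc j)"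
    using R by (intro eq_matI) (auto simp: algebra_simps simp del: index_mult_mat(1))
  finally show ?case by simp
qed

text \<open>Off the spectrum, differentiating \<open>C R B\<close> a total of \<open>j\<close>
  times, with \<open>R\<close> the resolvent, gives
  \<open>(-1)\<^sup>j j! C R\<^sup>j\<^sup>+\<^sup>1 B\<close>. The normalization in
  \<open>moment\<close> removes both the sign and the factorial.\<close>

lemma moment_eq_resolvent_pow:
  assumes A: "A \<in> carrier_mat n n" and B: "B \<in> carrier_mat n 1" and C: "C \<in> carrier_mat 1 n"
    and z: "z \<notin> spectrum (cmat A)"
  shows "moment A B C j z = (cmat C * resolvent (cmat A) z ^\<^sub>m Suc j * cmat B) $$ (0, 0)"
proof -
  let ?M = "cmat A"
  define g where "g j t = (cmat C * resolvent ?M t ^\<^sub>m Suc j * cmat B) $$ (0, 0)" for j t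
  have M: "?M \<in> carrier_mat n n" and c: "cmat C \<in> carrier_mat 1 n" "cmat B \<in> carrier_mat n 1"
    using A B C by auto
  have R: "resolvent ?M t ^\<^sub>m i \<in> carrier_mat n n" for t i using M by simp
  \<comment> \<open>Each \<open>g j\<close> differentiates to a multiple of
    \<open>g (Suc j)\<close>; this recursion drives the induction on the order of the
    derivative.\<close>
  have dg: "(g j has_field_derivative (- of_nat (Suc j)) * g (Suc j) t) (at t)"
    if t: "t \<notin> spectrum ?M" for j t
  proof -
    let ?D = "(- of_nat (Suc j)) \<cdot>\<^sub>m resolvent ?M t ^\<^sub>m Suc (Suc j)"
    have D: "?D \<in> carrier_mat n n" by (intro smult_carrier_mat R)
    have "has_mat_derivative 1 1 (\<lambda>t. cmat C * resolvent ?M t ^\<^sub>m Suc j * cmat B)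
      ((0\<^sub>m 1 n * resolvent ?M t ^\<^sub>m Suc j + cmat C * ?D) * cmat B +
        cmat C * resolvent ?M t ^\<^sub>m Suc j * 0\<^sub>m n 1) t"
      by (rule has_mat_derivative_mult[OF has_mat_derivative_mult[OF has_mat_derivative_const[OF c(1)]
            has_mat_derivative_resolvent_pow[OF M t]] has_mat_derivative_const[OF c(2)]])
    also have "(0\<^sub>m 1 n * resolvent ?M t ^\<^sub>m Suc j + cmat C * ?D) * cmat B +
        cmat C * resolvent ?M t ^\<^sub>m Suc j * 0\<^sub>m n 1 =
        (- of_nat (Suc j)) \<cdot>\<^sub>m (cmat C * resolvent ?M t ^\<^sub>m Suc (Suc j) * cmat B)"
    proof -
      have "0\<^sub>m 1 n * resolvent ?M t ^\<^sub>m Suc j + cmat C * ?D = cmat C * ?D"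
        using left_mult_zero_mat[OF R] left_add_zero_mat[OF mult_carrier_mat[OF c(1) D]] by metis
      moreover have "cmat C * resolvent ?M t ^\<^sub>m Suc j * 0\<^sub>m n 1 = 0\<^sub>m 1 1"
        by (rule right_mult_zero_mat[OF mult_carrier_mat[OF c(1) R]])
      moreover have "cmat C * ?D * cmat B = (- of_nat (Suc j)) \<cdot>\<^sub>m
          (cmat C * resolvent ?M t ^\<^sub>m Suc (Suc j) * cmat B)"
        unfolding mult_smult_distrib[OF c(1) R]
        by (rule mult_smult_assoc_mat[OF mult_carrier_mat[OF c(1) R] c(2)])
      moreover have "cmat C * ?D * cmat B \<in> carrier_mat 1 1" using c D by (metis mult_carrier_mat)
      ultimately show ?thesis by (metis right_add_zero_mat)
    qed
    finally show ?thesis using c R[of t "Suc (Suc j)"]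
      by (simp add: has_mat_derivative_def g_def[abs_def] del: pow_mat.simps index_mult_mat(1))
  qed
  have W: "transfer_function A B C t = g 0 t" if "t \<notin> spectrum ?M" for t
    using mat_inverse_eq_resolvent[OF M that] A M by (simp add: transfer_function_def g_def)
  have der: "(deriv ^^ j) (transfer_function A B C) t = (- 1) ^ j * fact j * g j t"
    if "t \<notin> spectrum ?M" for t using that
  proof (induction j arbitrary: t)
    case 0
    then show ?case using W by simp
  next
    case (Suc j)
    have "((\<lambda>t. (- 1) ^ j * fact j * g j t) has_field_derivative
        (- 1) ^ j * fact j * ((- of_nat (Suc j)) * g (Suc j) t)) (at t)"
      by (intro DERIV_cmult dg Suc.prems)
    \<comment> \<open>The induction hypothesis identifies the iterated derivative with this
      expression only off the spectrum. That set is open, so the derivatives at \<open>t\<close>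
      still agree.\<close>
    moreover have "(- 1) ^ j * fact j * g j t' = (deriv ^^ j) (transfer_function A B C) t'"
      if "t' \<in> - spectrum ?M" for t' using Suc.IH that by simp
    ultimately have "((deriv ^^ j) (transfer_function A B C) has_field_derivative
        (- 1) ^ j * fact j * ((- of_nat (Suc j)) * g (Suc j) t)) (at t)"
      using has_field_derivative_transform_within_open open_compl_spectrum[OF M] Suc.prems
      by (metis (no_types, lifting) ComplI)
    from DERIV_imp_deriv[OF this] show ?case by (simp add: algebra_simps)
  qed
  have "(- 1) ^ j * ((- 1 :: complex) ^ j) = 1"
    by (simp flip: power_mult_distrib)
  then show ?thesis unfolding moment_def der[OF z] g_def[symmetric]
    by (simp add: field_simps)
qed

subsection \<open>Columns of a Jordan matrix\<close>

text \<open>One entry for each column of the block-diagonal Jordan matrix: the eigenvalue of its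
  block and its position inside the block, counted from 0. Position 0 marks the start of a
  block.\<close>

definition jordan_indices :: "(nat \<times> 'a) list \<Rightarrow> ('a \<times> nat) list" where
  "jordan_indices bs = concat (map (\<lambda>(m, a). map (Pair a) [0..<m]) bs)"

lemma length_jordan_indices: "length (jordan_indices bs) = sum_list (map fst bs)"
  by (induction bs) (auto simp: jordan_indices_def)

lemma jordan_indices_Cons:
  "jordan_indices ((m, a) # bs) = map (Pair a) [0..<m] @ jordan_indices bs"
  by (simp add: jordan_indices_def)

lemma jordan_indices_Suc:
  assumes "c < length (jordan_indices bs)" "jordan_indices bs ! c = (a, Suc j)"
  shows "\<exists>c'. c = Suc c' \<and> jordan_indices bs ! c' = (a, j)"
  using assms
proof (induction bs arbitrary: c)
  case Nil
  then show ?case by (simp add: jordan_indices_def)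
next
  case (Cons b bs)
  obtain m a' where b: "b = (m, a')" by force
  show ?case
  proof (cases "c < m")
    case True
    then show ?thesis using Cons.prems unfolding b jordan_indices_Cons
      by (cases c) (auto simp: nth_append)
  next
    case False
    then have "jordan_indices bs ! (c - m) = (a, Suc j)" "c - m < length (jordan_indices bs)"
      using Cons.prems unfolding b jordan_indices_Cons by (auto simp: nth_append)
    from Cons.IH[OF this(2,1)] obtain c' where "c - m = Suc c'" "jordan_indices bs ! c' = (a, j)"
      by blast
    then show ?thesis using False unfolding b jordan_indices_Cons
      by (intro exI[of _ "m + c'"]) (auto simp: nth_append)
  qed
qed

lemma jordan_matrix_nth:
  assumes "r < length (jordan_indices bs)" "c < length (jordan_indices bs)"
  shows "jordan_matrix bs $$ (r, c) = (if r = c then fst (jordan_indices bs ! c)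
    else if Suc r = c \<and> snd (jordan_indices bs ! c) \<noteq> 0 then 1 else 0)"
  using assms
proof (induction bs arbitrary: r c)
  case Nil
  then show ?case by (simp add: jordan_indices_def)
next
  case (Cons b bs)
  obtain m a where b: "b = (m, a)" by force
  let ?l = "length (jordan_indices bs)"
  have l: "sum_list (map fst bs) = ?l" by (simp add: length_jordan_indices)
  have rc: "r < m + ?l" "c < m + ?l" using Cons.prems unfolding b jordan_indices_Cons by auto
  \<comment> \<open>Column 0 starts a block. Hence the column just beyond the first block carries no
    superdiagonal one, which is what case \<open>2\<close> below needs.\<close>
  have start: "snd (jordan_indices bs ! 0) = 0" if "?l > 0"
  proof (rule ccontr)
    assume "snd (jordan_indices bs ! 0) \<noteq> 0"
    then obtain a' j where "jordan_indices bs ! 0 = (a', Suc j)"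
      by (metis not0_implies_Suc prod.collapse)
    then show False using jordan_indices_Suc[of 0 bs a' j] that by auto
  qed
  have idx: "jordan_indices (b # bs) ! c =
      (if c < m then (a, c) else jordan_indices bs ! (c - m))"
    unfolding b jordan_indices_Cons by (auto simp: nth_append)
  consider "r < m" "c < m" | "r < m" "\<not> c < m" | "\<not> r < m" "c < m" | "\<not> r < m" "\<not> c < m"
    by blast
  then show ?case
  proof cases
    case 2
    then have "snd (jordan_indices bs ! (c - m)) = 0" if "Suc r = c"
    proof -
      have "c - m = 0" "?l > 0" using that 2 rc by linarith+
      then show ?thesis using start by simp
    qed
    moreover have "jordan_matrix (b # bs) $$ (r, c) = 0"
      using 2 rc by (simp add: b jordan_matrix_Cons l)
    ultimately show ?thesis using 2 unfolding idx by metis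
  next
    case 4
    have "jordan_matrix (b # bs) $$ (r, c) = jordan_matrix bs $$ (r - m, c - m)"
      using 4 rc by (simp add: b jordan_matrix_Cons l)
    then show ?thesis using 4 rc Cons.IH[of "r - m" "c - m"] unfolding idx by auto
  qed (use rc in \<open>auto simp: idx[unfolded b] b jordan_matrix_Cons l\<close>)
qed

section \<open>Indexing columns by interpolation point and order\<close>

definition block_list :: "nat \<Rightarrow> (nat \<Rightarrow> 'a) \<Rightarrow> (nat \<Rightarrow> nat) \<Rightarrow> (nat \<times> 'a) list" where
  "block_list N s k = map (\<lambda>i. (k i + 1, s i)) [0..<N]"

lemma length_block_indices: "length (jordan_indices (block_list N s k)) = (\<Sum>i<N. k i + 1)"
  by (induction N) (auto simp: block_list_def jordan_indices_def)

lemma set_block_indices: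
  "set (jordan_indices (block_list N s k)) = {(s i, j) | i j. i < N \<and> j \<le> k i}"
  by (force simp: block_list_def jordan_indices_def)

text \<open>Turns a sum over the columns of \<open>T\<close> into the double sum over points and
  orders that defines \<open>matching_index\<close>.\<close>

lemma sum_block_indices:
  fixes f :: "'a \<times> nat \<Rightarrow> 'b :: comm_monoid_add"
  shows "(\<Sum>c<(\<Sum>i<N. k i + 1). f (jordan_indices (block_list N s k) ! c)) =
     (\<Sum>i<N. \<Sum>j\<le>k i. f (s i, j))"
proof -
  have "(\<Sum>c<(\<Sum>i<N. k i + 1). f (jordan_indices (block_list N s k) ! c)) =
      sum_list (map f (jordan_indices (block_list N s k)))"
    by (simp add: sum_list_sum_nth length_block_indices atLeast0LessThan)
  also have "\<dots> = (\<Sum>i<N. \<Sum>j\<le>k i. f (s i, j))"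
  proof -
    have "sum_list (map g [0..<m + 1]) = (\<Sum>j\<le>m. g j)" for g :: "nat \<Rightarrow> 'b" and m
      unfolding Suc_eq_plus1[symmetric]
      by (simp add: interv_sum_list_conv_sum_set_nat atLeast0LessThan lessThan_Suc_atMost
          del: upt_Suc sum.lessThan_Suc)
    then show ?thesis
      by (induction N) (simp_all add: block_list_def jordan_indices_def comp_def)
  qed
  finally show ?thesis .
qed

lemma Lambda_row_carrier: "Lambda_row N k \<in> carrier_mat 1 (\<Sum>i<N. k i + 1)"
  by (simp add: Lambda_row_def mat_of_rows_list_def One_nat_def)

text \<open>Here \<open>s\<close> is arbitrary, since \<open>Lambda_row\<close> sees only the
  positions in the blocks and not the eigenvalues.\<close>

lemma Lambda_row_nth:
  assumes "c < (\<Sum>i<N. k i + 1)"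
  shows "Lambda_row N k $$ (0, c) = (if snd (jordan_indices (block_list N s k) ! c) = 0 then 1 else 0)"
proof -
  let ?f = "\<lambda>(a, j). if j = 0 then 1 else (0 :: complex)"
  have "map (\<lambda>j. if j = 0 then 1 else 0) [0..<m + 1] = 1 # replicate m (0 :: complex)" for m
    by (rule nth_equalityI) (auto simp: nth_Cons')
  then have "concat (map (\<lambda>i. 1 # replicate (k i) 0) [0..<N]) =
      map ?f (jordan_indices (block_list N s k))"
    by (simp add: jordan_indices_def block_list_def map_concat comp_def)
  then show ?thesis using assms length_block_indices[of N s k]
    by (simp add: Lambda_row_def mat_of_rows_list_def split: prod.splits)
qed

lemma jordan_form_block_list: "jordan_form N s k = jordan_matrix (block_list N s k)"
  by (simp add: jordan_form_def block_list_def)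

text \<open>For \<open>a\<close> off the spectrum of \<open>M\<close> these columns solve the chain
  \<open>(a - M) y\<^sub>0 = g\<close>,
  \<open>(a - M) y\<^sub>j\<^sub>+\<^sub>1 = - y\<^sub>j\<close>, which a Jordan block at
  \<open>a\<close> imposes on successive columns of a Sylvester solution.\<close>

definition krylov_column :: "complex mat \<Rightarrow> complex mat \<Rightarrow> complex \<times> nat \<Rightarrow> complex mat" where
  "krylov_column M g = (\<lambda>(a, j). (- 1) ^ j \<cdot>\<^sub>m (resolvent M a ^\<^sub>m Suc j * g))"

lemma krylov_column_carrier:
  "M \<in> carrier_mat n n \<Longrightarrow> g \<in> carrier_mat n 1 \<Longrightarrow> krylov_column M g x \<in> carrier_mat n 1"
  by (cases x) (auto simp: krylov_column_def simp del: pow_mat.simps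
      intro!: smult_carrier_mat mult_carrier_mat[of _ n n])

lemma krylov_column_0:
  assumes "M \<in> carrier_mat n n" "g \<in> carrier_mat n 1"
  shows "krylov_column M g (a, 0) = resolvent M a * g"
proof -
  have "resolvent M a * g \<in> carrier_mat n 1" "resolvent M a ^\<^sub>m Suc 0 = resolvent M a"
    using assms mult_carrier_mat[OF resolvent_carrier] by auto
  then show ?thesis by (auto simp: krylov_column_def simp del: index_mult_mat(1) pow_mat.simps intro!: eq_matI)
qed

lemma krylov_column_Suc:
  assumes "M \<in> carrier_mat n n" "g \<in> carrier_mat n 1"
  shows "krylov_column M g (a, Suc j) = resolvent M a * (- krylov_column M g (a, j))"
proof -
  have R: "resolvent M a \<in> carrier_mat n n" using assms by simp
  then have P: "resolvent M a ^\<^sub>m j \<in> carrier_mat n n" "resolvent M a ^\<^sub>m Suc j \<in> carrier_mat n n"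
    by (rule pow_carrier_mat)+
  have "resolvent M a ^\<^sub>m Suc (Suc j) * g = resolvent M a * (resolvent M a ^\<^sub>m Suc j * g)"
    using pow_mat_commute_self[OF R, of "Suc j"] R P(2) assms assoc_mult_mat[OF R P(2) assms(2)]
    by simp
  moreover have "- ((- 1) ^ j \<cdot>\<^sub>m (resolvent M a ^\<^sub>m Suc j * g)) =
      (- 1) ^ Suc j \<cdot>\<^sub>m (resolvent M a ^\<^sub>m Suc j * g)"
    using P(2) assms by (intro eq_matI) auto
  ultimately show ?thesis
    using mult_smult_distrib[OF R, of "resolvent M a ^\<^sub>m Suc j * g" 1] P(2) assms
    by (simp add: krylov_column_def del: pow_mat.simps)
qed

lemma resolvent_solves_iff:
  fixes M :: "'a :: field mat"
  assumes M: "M \<in> carrier_mat n n" and z: "z \<notin> spectrum M"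
    and y: "y \<in> carrier_mat n 1" and b: "b \<in> carrier_mat n 1"
  shows "M * y + b = z \<cdot>\<^sub>m y \<longleftrightarrow> y = resolvent M z * b"
proof -
  let ?Z = "z \<cdot>\<^sub>m 1\<^sub>m n - M"
  have Z: "?Z \<in> carrier_mat n n" and R: "resolvent M z \<in> carrier_mat n n" using M by auto
  have "?Z * y = z \<cdot>\<^sub>m y - M * y"
    using M y by (simp add: minus_mult_distrib_mat[of _ n n _ _ 1] mult_smult_assoc_mat[of _ n n _ 1])
  moreover have "X + b = Y \<longleftrightarrow> Y - X = b"
    if "X \<in> carrier_mat n 1" "Y \<in> carrier_mat n 1" for X Y
    using that b by (auto simp: mat_eq_iff algebra_simps)
  moreover have "?Z * y = b \<longleftrightarrow> y = resolvent M z * b"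
  proof
    assume eq: "?Z * y = b"
    show "y = resolvent M z * b"
      unfolding eq[symmetric] using assoc_mult_mat[OF R Z y] y resolvent_left[OF M z] by simp
  next
    assume eq: "y = resolvent M z * b"
    show "?Z * y = b"
      unfolding eq using assoc_mult_mat[OF Z R b] b resolvent_right[OF M z] by simp
  qed
  ultimately show ?thesis using mult_carrier_mat[OF M y] y by simp
qed

subsection \<open>The Sylvester equation in Jordan coordinates\<close>

lemma mat_eq_iff_entries:
  assumes "X \<in> carrier_mat n m" "Y \<in> carrier_mat n m"
  shows "X = Y \<longleftrightarrow> (\<forall>i<n. \<forall>c<m. X $$ (i, c) = Y $$ (i, c))"
  using assms by (auto simp: mat_eq_iff)

lemma column_eq_iff_entries:
  assumes "X \<in> carrier_mat n 1" "Y \<in> carrier_mat n 1"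
  shows "X = Y \<longleftrightarrow> (\<forall>i<n. X $$ (i, 0) = Y $$ (i, 0))"
  unfolding mat_eq_iff_entries[OF assms] by (simp add: less_one)

text \<open>A column of a Jordan matrix has at most two nonzero entries: the eigenvalue on the
  diagonal and, inside a block, a one just above it. Column 0 starts a block, so the truncated
  \<open>c - 1\<close> does no harm there.\<close>

lemma mult_jordan_matrix_nth:
  fixes Y :: "'a :: comm_semiring_1 mat"
  assumes Y: "Y \<in> carrier_mat n (length (jordan_indices bs))"
    and i: "i < n" and c: "c < length (jordan_indices bs)"
  shows "(Y * jordan_matrix bs) $$ (i, c) = fst (jordan_indices bs ! c) * Y $$ (i, c) +
    (if snd (jordan_indices bs ! c) = 0 then 0 else Y $$ (i, c - 1))"
proof -
  let ?l = "length (jordan_indices bs)"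
  obtain a j where ac: "jordan_indices bs ! c = (a, j)" by force
  have J: "jordan_matrix bs \<in> carrier_mat ?l ?l"
    using jordan_matrix_carrier[of bs] by (simp add: length_jordan_indices)
  have "(Y * jordan_matrix bs) $$ (i, c) = (\<Sum>r<?l. Y $$ (i, r) * jordan_matrix bs $$ (r, c))"
    by (rule sum_mat_mult[OF Y J i c])
  also have "\<dots> = (\<Sum>r<?l. (if r = c then a * Y $$ (i, c) else 0) +
      (if Suc r = c then if j = 0 then 0 else Y $$ (i, c - 1) else 0))"
    using c by (intro sum.cong refl) (auto simp: jordan_matrix_nth ac mult.commute)
  also have "\<dots> = a * Y $$ (i, c) + (\<Sum>r<?l. if Suc r = c then if j = 0 then 0 else Y $$ (i, c - 1) else 0)"
    using c by (simp add: sum.distrib)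
  also have "(\<Sum>r<?l. if Suc r = c then if j = 0 then 0 else Y $$ (i, c - 1) else 0) =
      (if j = 0 then 0 else Y $$ (i, c - 1))"
  proof (cases j)
    case 0
    then show ?thesis by (simp add: sum.neutral)
  next
    case (Suc j')
    then obtain c' where c': "c = Suc c'" using jordan_indices_Suc[OF c, of a j'] ac by auto
    then have "(\<Sum>r<?l. if Suc r = c then if j = 0 then 0 else Y $$ (i, c - 1) else 0) =
        (\<Sum>r<?l. if r = c' then Y $$ (i, c - 1) else 0)"
      using Suc by (intro sum.cong) auto
    then show ?thesis using c c' Suc by simp
  qed
  finally show ?thesis by (simp add: ac)
qed

text \<open>The matrix equation splits into one resolvent equation per column. Since
  \<open>M\<close> avoids the eigenvalues of the Jordan matrix, each column is determined by
  \<open>g\<close> or by the previous column of its block, and the Krylov columns solve this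
  recursion. The equivalence gives existence and uniqueness together.\<close>

lemma sylvester_jordan_iff:
  fixes M :: "complex mat"
  assumes M: "M \<in> carrier_mat n n" and g: "g \<in> carrier_mat n 1"
    and Y: "Y \<in> carrier_mat n (length (jordan_indices bs))"
    and \<Lambda>: "\<Lambda> \<in> carrier_mat 1 (length (jordan_indices bs))"
      "\<And>c. c < length (jordan_indices bs) \<Longrightarrow>
        \<Lambda> $$ (0, c) = (if snd (jordan_indices bs ! c) = 0 then 1 else 0)"
    and disjoint: "\<And>a j. (a, j) \<in> set (jordan_indices bs) \<Longrightarrow> a \<notin> spectrum M"
  shows "M * Y + g * \<Lambda> = Y * jordan_matrix bs \<longleftrightarrow>
    Y = mat n (length (jordan_indices bs)) (\<lambda>(i, c). krylov_column M g (jordan_indices bs ! c) $$ (i, 0))"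
    (is "?eq \<longleftrightarrow> Y = ?K")
proof -
  let ?ix = "jordan_indices bs"
  define y where "y c = mat n 1 (\<lambda>(i, _). Y $$ (i, c))" for c
  have y: "y c \<in> carrier_mat n 1" for c by (simp add: y_def)
  \<comment> \<open>\<open>b c\<close> is the inhomogeneity in column \<open>c\<close>: it is
    \<open>g\<close> where \<open>\<Lambda>\<close> has a one, and otherwise minus the preceding
    column, moved over from the superdiagonal one.\<close>
  define b where "b c = (if snd (?ix ! c) = 0 then g else - y (c - 1))" for c
  have b: "b c \<in> carrier_mat n 1" for c using g y by (simp add: b_def)
  have J: "jordan_matrix bs \<in> carrier_mat (length ?ix) (length ?ix)"
    using jordan_matrix_carrier[of bs] by (simp add: length_jordan_indices)
  have notin: "fst (?ix ! c) \<notin> spectrum M" if "c < length ?ix" for c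
    using that disjoint[of "fst (?ix ! c)" "snd (?ix ! c)"] by simp
  have entry: "(M * Y + g * \<Lambda>) $$ (i, c) = (Y * jordan_matrix bs) $$ (i, c) \<longleftrightarrow>
      (M * y c + b c) $$ (i, 0) = (fst (?ix ! c) \<cdot>\<^sub>m y c) $$ (i, 0)"
    if i: "i < n" and c: "c < length ?ix" for i c
  proof -
    have "(M * Y) $$ (i, c) = (M * y c) $$ (i, 0)"
      using sum_mat_mult[OF M Y i c] sum_mat_mult[OF M y i, of 0 c] by (simp add: y_def)
    moreover have "(g * \<Lambda>) $$ (i, c) = g $$ (i, 0) * \<Lambda> $$ (0, c)"
      using sum_mat_mult[OF g \<Lambda>(1) i c] by (simp add: One_nat_def)
    moreover have "(M * Y + g * \<Lambda>) $$ (i, c) = (M * Y) $$ (i, c) + (g * \<Lambda>) $$ (i, c)"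
      using g \<Lambda> i c by (intro index_add_mat) auto
    moreover have "(M * y c + b c) $$ (i, 0) = (M * y c) $$ (i, 0) + b c $$ (i, 0)"
      using b[of c] i by (intro index_add_mat) auto
    moreover have "(fst (?ix ! c) \<cdot>\<^sub>m y c) $$ (i, 0) = fst (?ix ! c) * Y $$ (i, c)"
      using i by (simp add: y_def)
    moreover have "b c $$ (i, 0) = (if snd (?ix ! c) = 0 then g $$ (i, 0) else - Y $$ (i, c - 1))"
      using i by (simp add: b_def y_def)
    ultimately show ?thesis
      using mult_jordan_matrix_nth[OF Y i c] \<Lambda>(2)[OF c] by (auto simp: algebra_simps)
  qed
  have "?eq \<longleftrightarrow> (\<forall>i<n. \<forall>c<length ?ix. (M * Y + g * \<Lambda>) $$ (i, c) = (Y * jordan_matrix bs) $$ (i, c))"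
    by (rule mat_eq_iff_entries)
      (rule add_carrier_mat[OF mult_carrier_mat[OF g \<Lambda>(1)]], rule mult_carrier_mat[OF Y J])
  also have "\<dots> \<longleftrightarrow> (\<forall>c<length ?ix. M * y c + b c = fst (?ix ! c) \<cdot>\<^sub>m y c)"
  proof -
    have "M * y c + b c = fst (?ix ! c) \<cdot>\<^sub>m y c \<longleftrightarrow>
        (\<forall>i<n. (M * y c + b c) $$ (i, 0) = (fst (?ix ! c) \<cdot>\<^sub>m y c) $$ (i, 0))" for c
      by (rule column_eq_iff_entries) (rule add_carrier_mat[OF b], rule smult_carrier_mat[OF y])
    then show ?thesis using entry by auto
  qed
  also have "\<dots> \<longleftrightarrow> (\<forall>c<length ?ix. y c = resolvent M (fst (?ix ! c)) * b c)"
    using resolvent_solves_iff[OF M notin y b] by simp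
  also have "\<dots> \<longleftrightarrow> (\<forall>c<length ?ix. y c = krylov_column M g (?ix ! c))" (is "?l \<longleftrightarrow> ?r")
  proof -
    \<comment> \<open>The Krylov columns obey the same recursion as the columns \<open>y c\<close>,
      so agreement propagates from each column to the next.\<close>
    have step: "krylov_column M g (?ix ! c) = resolvent M (fst (?ix ! c)) *
        (if snd (?ix ! c) = 0 then g else - krylov_column M g (?ix ! (c - 1)))"
      if c: "c < length ?ix" for c
    proof -
      obtain a j where aj: "?ix ! c = (a, j)" by force
      show ?thesis
        using jordan_indices_Suc[OF c] aj
        by (cases j) (auto simp: krylov_column_0[OF M g] krylov_column_Suc[OF M g])
    qed
    show ?thesis
    proof
      assume l: ?l
      have "c < length ?ix \<Longrightarrow> y c = krylov_column M g (?ix ! c)" for c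
      proof (induction c)
        case 0
        then have "snd (?ix ! 0) = 0"
          using jordan_indices_Suc[OF 0] by (metis nat.distinct(1) not0_implies_Suc prod.collapse)
        then show ?case using l 0 step[OF 0] by (simp add: b_def)
      next
        case (Suc c)
        then show ?case using l step[OF Suc.prems] by (simp add: b_def)
      qed
      then show ?r by blast
    next
      assume r: ?r
      show ?l
      proof (intro allI impI)
        fix c assume c: "c < length ?ix"
        have "c - 1 < length ?ix" using c by simp
        then show "y c = resolvent M (fst (?ix ! c)) * b c"
          using r step[OF c] c by (simp add: b_def)
      qed
    qed
  qed
  also have "\<dots> \<longleftrightarrow> Y = ?K"
  proof -
    have "y c = krylov_column M g (?ix ! c) \<longleftrightarrow>
        (\<forall>i<n. Y $$ (i, c) = krylov_column M g (?ix ! c) $$ (i, 0))" for c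
      unfolding column_eq_iff_entries[OF y krylov_column_carrier[OF M g]] by (simp add: y_def)
    moreover have "Y = ?K \<longleftrightarrow> (\<forall>i<n. \<forall>c<length ?ix. Y $$ (i, c) = krylov_column M g (?ix ! c) $$ (i, 0))"
      by (subst mat_eq_iff_entries[OF Y]) auto
    ultimately show ?thesis by auto
  qed
  finally show ?thesis .
qed

section \<open>Passing between real and complex matrices\<close>

lemma cmat_mult:
  "A \<in> carrier_mat n m \<Longrightarrow> B \<in> carrier_mat m l \<Longrightarrow> cmat (A * B) = cmat A * cmat B"
  by (rule of_real_hom.mat_hom_mult)

lemma cmat_add:
  "A \<in> carrier_mat n m \<Longrightarrow> B \<in> carrier_mat n m \<Longrightarrow> cmat (A + B) = cmat A + cmat B"
  by (intro eq_matI) auto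

lemma cmat_minus:
  "A \<in> carrier_mat n m \<Longrightarrow> B \<in> carrier_mat n m \<Longrightarrow> cmat (A - B) = cmat A - cmat B"
  by (intro eq_matI) auto

lemma cmat_inj: "cmat A = cmat B \<Longrightarrow> A = B"
  by (auto simp: mat_eq_iff)

text \<open>For extracting a real solution of a linear matrix equation with real coefficients from a
  complex one.\<close>

lemma Re_mult_cmat:
  assumes "A \<in> carrier_mat n m" "Y \<in> carrier_mat m l"
  shows "map_mat Re (cmat A * Y) = A * map_mat Re Y"
proof (rule eq_matI)
  fix i j assume "i < dim_row (A * map_mat Re Y)" "j < dim_col (A * map_mat Re Y)"
  then have ij: "i < n" "j < l" using assms by auto
  have "(cmat A * Y) $$ (i, j) = (\<Sum>k<m. cmat A $$ (i, k) * Y $$ (k, j))"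
    using assms ij by (intro sum_mat_mult) auto
  moreover have "(A * map_mat Re Y) $$ (i, j) = (\<Sum>k<m. A $$ (i, k) * map_mat Re Y $$ (k, j))"
    using assms ij by (intro sum_mat_mult) auto
  ultimately show "map_mat Re (cmat A * Y) $$ (i, j) = (A * map_mat Re Y) $$ (i, j)"
    using assms ij by (simp add: Re_sum del: index_mult_mat(1))
qed (use assms in auto)

lemma Re_mult_cmat_right:
  assumes "Y \<in> carrier_mat n m" "A \<in> carrier_mat m l"
  shows "map_mat Re (Y * cmat A) = map_mat Re Y * A"
proof (rule eq_matI)
  fix i j assume "i < dim_row (map_mat Re Y * A)" "j < dim_col (map_mat Re Y * A)"
  then have ij: "i < n" "j < l" using assms by auto
  have "(Y * cmat A) $$ (i, j) = (\<Sum>k<m. Y $$ (i, k) * cmat A $$ (k, j))"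
    using assms ij by (intro sum_mat_mult) auto
  moreover have "(map_mat Re Y * A) $$ (i, j) = (\<Sum>k<m. map_mat Re Y $$ (i, k) * A $$ (k, j))"
    using assms ij by (intro sum_mat_mult) auto
  ultimately show "map_mat Re (Y * cmat A) $$ (i, j) = (map_mat Re Y * A) $$ (i, j)"
    using assms ij by (simp add: Re_sum del: index_mult_mat(1))
qed (use assms in auto)

section \<open>Interpolation data and the equality of the two cost functions\<close>

locale interpolation_data =
  fixes S L :: "real mat" and T :: "complex mat" and \<nu> N :: nat
    and s :: "nat \<Rightarrow> complex" and k :: "nat \<Rightarrow> nat"
  assumes S: "S \<in> carrier_mat \<nu> \<nu>" and L: "L \<in> carrier_mat 1 \<nu>"
    and T: "T \<in> carrier_mat \<nu> \<nu>" and T_inv: "invertible_mat T"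
    and \<nu>: "\<nu> = (\<Sum>i<N. k i + 1)"
    and char_poly_S: "char_poly (cmat S) = (\<Prod>i<N. [:- s i, 1:] ^ (k i + 1))"
    and ST: "cmat S * T = T * jordan_form N s k"
    and LT: "cmat L * T = Lambda_row N k"
begin

abbreviation "ix \<equiv> jordan_indices (block_list N s k)"

lemma length_ix: "length ix = \<nu>"
  by (simp add: length_block_indices \<nu>)

lemma spectrum_S: "spectrum (cmat S) = s ` {..<N}"
  using S by (auto simp: spectrum_iff_root[of _ \<nu>] char_poly_S poly_prod)

lemma moments_well_defined_iff:
  "moments_well_defined N s F \<longleftrightarrow> spectrum (cmat S) \<inter> spectrum (cmat F) = {}"
  by (auto simp: moments_well_defined_def spectrum_S)

lemma ix_in_spectrum: "(a, j) \<in> set ix \<Longrightarrow> a \<in> spectrum (cmat S)"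
  by (auto simp: set_block_indices spectrum_S)

definition krylov_mat :: "complex mat \<Rightarrow> complex mat \<Rightarrow> complex mat" where
  "krylov_mat M g = mat (dim_row M) \<nu> (\<lambda>(i, c). krylov_column M g (ix ! c) $$ (i, 0))"

lemma inverse_T: obtains T' where "T' \<in> carrier_mat \<nu> \<nu>" "T * T' = 1\<^sub>m \<nu>" "T' * T = 1\<^sub>m \<nu>"
proof -
  obtain T' where "T * T' = 1\<^sub>m (dim_row T)" "T' * T = 1\<^sub>m (dim_row T')"
    using T_inv by (auto simp: invertible_mat_def inverts_mat_def)
  moreover from this have "T' \<in> carrier_mat \<nu> \<nu>"
    using T by (metis carrier_matD carrier_matI index_mult_mat(2,3) index_one_mat(2,3))
  ultimately show ?thesis using that T by auto
qed

text \<open>Right multiplication by the invertible \<open>T\<close> replaces \<open>S\<close> by its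
  Jordan form, \<open>L\<close> by the row of block starts and the unknown \<open>Y\<close> by
  \<open>Y T\<close>.\<close>

lemma sylvester_iff:
  assumes M: "M \<in> carrier_mat n n" and g: "g \<in> carrier_mat n 1" and Y: "Y \<in> carrier_mat n \<nu>"
    and disjoint: "spectrum (cmat S) \<inter> spectrum M = {}"
  shows "M * Y + g * cmat L = Y * cmat S \<longleftrightarrow> Y * T = krylov_mat M g"
proof -
  have c: "cmat S \<in> carrier_mat \<nu> \<nu>" "cmat L \<in> carrier_mat 1 \<nu>" using S L by auto
  have YT: "Y * T \<in> carrier_mat n (length ix)" using Y T by (simp add: length_ix)
  obtain T' where T': "T' \<in> carrier_mat \<nu> \<nu>" "T * T' = 1\<^sub>m \<nu>" using inverse_T .
  have lhs: "M * Y + g * cmat L \<in> carrier_mat n \<nu>" and rhs: "Y * cmat S \<in> carrier_mat n \<nu>"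
    using M Y g c by auto
  have cancel: "X = Z" if "X * T = Z * T" "X \<in> carrier_mat n \<nu>" "Z \<in> carrier_mat n \<nu>" for X Z
  proof -
    have "W * T * T' = W" if "W \<in> carrier_mat n \<nu>" for W
      using assoc_mult_mat[OF that T T'(1)] T'(2) that by simp
    then show ?thesis using that by metis
  qed
  have "(M * Y + g * cmat L) * T = M * (Y * T) + g * Lambda_row N k"
    using add_mult_distrib_mat[OF mult_carrier_mat[OF M Y] mult_carrier_mat[OF g c(2)] T]
      assoc_mult_mat[OF M Y T] assoc_mult_mat[OF g c(2) T] LT by simp
  moreover have "Y * cmat S * T = Y * T * jordan_matrix (block_list N s k)"
  proof -
    have J: "jordan_matrix (block_list N s k) \<in> carrier_mat \<nu> \<nu>"
      using jordan_matrix_carrier[of "block_list N s k"]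
      by (simp add: length_ix flip: length_jordan_indices)
    show ?thesis
      using assoc_mult_mat[OF Y c(1) T] assoc_mult_mat[OF Y T J] ST by (simp add: jordan_form_block_list)
  qed
  ultimately have "M * Y + g * cmat L = Y * cmat S \<longleftrightarrow>
      M * (Y * T) + g * Lambda_row N k = Y * T * jordan_matrix (block_list N s k)"
    using cancel[OF _ lhs rhs] by auto
  also have "\<dots> \<longleftrightarrow> Y * T = krylov_mat M g"
  proof -
    have "krylov_mat M g = mat n (length ix) (\<lambda>(i, c). krylov_column M g (ix ! c) $$ (i, 0))"
      using M by (simp add: krylov_mat_def length_ix)
    moreover have "Lambda_row N k \<in> carrier_mat 1 (length ix)"
      using Lambda_row_carrier by (simp add: length_block_indices)
    moreover have "Lambda_row N k $$ (0, c) = (if snd (ix ! c) = 0 then 1 else 0)"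
      if "c < length ix" for c
      using that by (intro Lambda_row_nth) (simp add: length_block_indices)
    moreover have "a \<notin> spectrum M" if "(a, j) \<in> set ix" for a j
      using ix_in_spectrum[OF that] disjoint by blast
    ultimately show ?thesis using sylvester_jordan_iff[OF M g YT] by metis
  qed
  finally show ?thesis .
qed

lemma sylvester_real_iff:
  assumes "F \<in> carrier_mat r r" "G \<in> carrier_mat r 1" "P \<in> carrier_mat r \<nu>"
    and "spectrum (cmat S) \<inter> spectrum (cmat F) = {}"
  shows "F * P + G * L = P * S \<longleftrightarrow> cmat P * T = krylov_mat (cmat F) (cmat G)"
proof -
  have "F * P + G * L = P * S \<longleftrightarrow> cmat (F * P + G * L) = cmat (P * S)"
    using cmat_inj by metis
  also have "cmat (F * P + G * L) = cmat F * cmat P + cmat G * cmat L"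
    using assms L by (simp add: cmat_add[of _ r \<nu>] cmat_mult[of _ r r _ \<nu>] cmat_mult[of _ r 1 _ \<nu>])
  also have "cmat (P * S) = cmat P * cmat S"
    using assms S by (simp add: cmat_mult[of _ r \<nu> _ \<nu>])
  finally show ?thesis using sylvester_iff[of "cmat F" r "cmat G" "cmat P"] assms by simp
qed

text \<open>The Krylov matrix times \<open>T\<^sup>-\<^sup>1\<close> is a complex solution. All
  coefficients being real, its real part is a solution too.\<close>

lemma sylvester_exists:
  assumes F: "F \<in> carrier_mat r r" and G: "G \<in> carrier_mat r 1"
    and disjoint: "spectrum (cmat S) \<inter> spectrum (cmat F) = {}"
  shows "\<exists>P \<in> carrier_mat r \<nu>. F * P + G * L = P * S"
proof -
  obtain T' where T': "T' \<in> carrier_mat \<nu> \<nu>" "T' * T = 1\<^sub>m \<nu>" using inverse_T .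
  let ?K = "krylov_mat (cmat F) (cmat G)"
  define Y where "Y = ?K * T'"
  have K: "?K \<in> carrier_mat r \<nu>" using F by (simp add: krylov_mat_def)
  have Y: "Y \<in> carrier_mat r \<nu>" using K T' by (simp add: Y_def)
  have "Y * T = ?K"
    using assoc_mult_mat[OF K T'(1) T] T' K by (simp add: Y_def)
  then have "cmat F * Y + cmat G * cmat L = Y * cmat S"
    using sylvester_iff[of "cmat F" r "cmat G" Y] F G Y disjoint by simp
  then have "map_mat Re (cmat F * Y + cmat (G * L)) = map_mat Re (Y * cmat S)"
    using cmat_mult[OF G L] by simp
  moreover have "map_mat Re (cmat F * Y + cmat (G * L)) = map_mat Re (cmat F * Y) + G * L"
    using F G L Y by (intro eq_matI) auto
  ultimately have "F * map_mat Re Y + G * L = map_mat Re Y * S"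
    using Re_mult_cmat[OF F Y] Re_mult_cmat_right[OF Y S] by simp
  then show ?thesis using Y by (intro bexI[of _ "map_mat Re Y"]) auto
qed

text \<open>The column of \<open>P T\<close> at \<open>(a, j)\<close> is
  \<open>(-1)\<^sup>j R\<^sup>j\<^sup>+\<^sup>1 G\<close> with \<open>R\<close> the resolvent of
  \<open>F\<close> at \<open>a\<close>, so applying \<open>H\<close> produces a moment. This serves
  twice: for the models, and for \<open>(A, B, C)\<close> with \<open>Pi_sol\<close> in the role of
  \<open>P\<close>.\<close>

lemma output_row_nth:
  assumes F: "F \<in> carrier_mat r r" and G: "G \<in> carrier_mat r 1" and H: "H \<in> carrier_mat 1 r"
    and P: "P \<in> carrier_mat r \<nu>" and syl: "F * P + G * L = P * S"
    and disjoint: "spectrum (cmat S) \<inter> spectrum (cmat F) = {}"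
    and c: "c < \<nu>" and aj: "ix ! c = (a, j)"
  shows "(cmat (H * P) * T) $$ (0, c) = (- 1) ^ j * moment F G H j a"
proof -
  have h: "cmat H \<in> carrier_mat 1 r" "cmat F \<in> carrier_mat r r" "cmat G \<in> carrier_mat r 1"
    "cmat P \<in> carrier_mat r \<nu>"
    using F G H P by auto
  have "(a, j) \<in> set ix" using c aj length_ix by (metis nth_mem)
  then have a: "a \<notin> spectrum (cmat F)" using ix_in_spectrum disjoint by blast
  let ?x = "krylov_column (cmat F) (cmat G) (a, j)" and ?K = "krylov_mat (cmat F) (cmat G)"
  have R: "resolvent (cmat F) a ^\<^sub>m Suc j \<in> carrier_mat r r"
    by (rule pow_carrier_mat[OF resolvent_carrier[OF h(2)]])
  have x: "?x \<in> carrier_mat r 1" by (rule krylov_column_carrier[OF h(2,3)])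
  have K: "?K \<in> carrier_mat r \<nu>" using F by (simp add: krylov_mat_def)
  have "cmat (H * P) * T = cmat H * (cmat P * T)"
    using cmat_mult[OF H P] assoc_mult_mat[OF h(1,4) T] by simp
  also have "cmat P * T = ?K" using sylvester_real_iff[OF F G P disjoint] syl by simp
  also have "(cmat H * ?K) $$ (0, c) = (cmat H * ?x) $$ (0, 0)"
    using sum_mat_mult[OF h(1) K _ c, of 0] sum_mat_mult[OF h(1) x, of 0 0] F c aj
    by (simp add: krylov_mat_def)
  also have "cmat H * ?x = (- 1) ^ j \<cdot>\<^sub>m (cmat H * resolvent (cmat F) a ^\<^sub>m Suc j * cmat G)"
    unfolding krylov_column_def prod.case mult_smult_distrib[OF h(1) mult_carrier_mat[OF R h(3)]]
      assoc_mult_mat[OF h(1) R h(3)] ..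
  also have "\<dots> $$ (0, 0) = (- 1) ^ j * moment F G H j a"
    unfolding moment_eq_resolvent_pow[OF F G H a] using h by (intro index_smult_mat) auto
  finally show ?thesis .
qed

lemma objective_eq_sum:
  assumes E: "C * Pi_sol - H * P \<in> carrier_mat 1 \<nu>"
  shows "objective C Pi_sol T H P = (\<Sum>c<\<nu>. (cmod ((cmat (C * Pi_sol - H * P) * T) $$ (0, c)))\<^sup>2)"
proof -
  have "cmat (C * Pi_sol - H * P) * T \<in> carrier_mat 1 \<nu>" using E T by auto
  then show ?thesis
    by (simp add: objective_def dual_norm_eq_L2_set L2_set_def sum_nonneg)
qed

text \<open>In the coordinates of \<open>T\<close> each entry of the error row is a difference of
  moments times \<open>(-1)\<^sup>j\<close>, and the sign disappears in the modulus.\<close>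

lemma objective_eq_matching_index:
  assumes A: "A \<in> carrier_mat n n" and B: "B \<in> carrier_mat n 1" and C: "C \<in> carrier_mat 1 n"
    and Pi_sol: "Pi_sol \<in> carrier_mat n \<nu>" "A * Pi_sol + B * L = Pi_sol * S"
    and disjoint: "spectrum (cmat S) \<inter> spectrum (cmat A) = {}"
    and feasible: "feasible S L r F G H P"
  shows "objective C Pi_sol T H P = matching_index A B C N s k F G H"
proof -
  have F: "F \<in> carrier_mat r r" and G: "G \<in> carrier_mat r 1" and H: "H \<in> carrier_mat 1 r"
    and P: "P \<in> carrier_mat r \<nu>" "F * P + G * L = P * S"
    and disjoint_F: "spectrum (cmat S) \<inter> spectrum (cmat F) = {}"
    using feasible S by (auto simp: feasible_def is_model_def)
  have CP: "C * Pi_sol \<in> carrier_mat 1 \<nu>" and HP: "H * P \<in> carrier_mat 1 \<nu>"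
    using C Pi_sol(1) H P(1) by auto
  then have cc: "cmat (C * Pi_sol) \<in> carrier_mat 1 \<nu>" "cmat (H * P) \<in> carrier_mat 1 \<nu>" by auto
  let ?f = "\<lambda>(a, j). (cmod (moment A B C j a - moment F G H j a))\<^sup>2"
  have "(cmod ((cmat (C * Pi_sol - H * P) * T) $$ (0, c)))\<^sup>2 = ?f (ix ! c)" if c: "c < \<nu>" for c
  proof -
    obtain a j where aj: "ix ! c = (a, j)" by force
    have "cmat (C * Pi_sol - H * P) * T = cmat (C * Pi_sol) * T - cmat (H * P) * T"
      unfolding cmat_minus[OF CP HP] by (rule minus_mult_distrib_mat[OF cc T])
    also have "\<dots> $$ (0, c) = (cmat (C * Pi_sol) * T) $$ (0, c) - (cmat (H * P) * T) $$ (0, c)"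
      using cc T c by (intro index_minus_mat) auto
    also have "\<dots> = (- 1) ^ j * (moment A B C j a - moment F G H j a)"
      using output_row_nth[OF A B C Pi_sol disjoint c aj] output_row_nth[OF F G H P disjoint_F c aj]
      by (simp add: algebra_simps)
    finally show ?thesis by (simp add: aj norm_mult norm_power)
  qed
  moreover have "C * Pi_sol - H * P \<in> carrier_mat 1 \<nu>" by (rule minus_carrier_mat[OF HP])
  ultimately have "objective C Pi_sol T H P = (\<Sum>c<\<nu>. ?f (ix ! c))"
    by (simp add: objective_eq_sum)
  also have "\<dots> = matching_index A B C N s k F G H"
    unfolding \<nu> sum_block_indices matching_index_def by simp
  finally show ?thesis .
qed

end

subsection \<open>Orthogonality and left kernels\<close>

lemma mat_one_one_eq_zero_iff:
  "X \<in> carrier_mat 1 1 \<Longrightarrow> X = 0\<^sub>m 1 1 \<longleftrightarrow> X $$ (0, 0) = 0"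
  by (auto simp: mat_eq_iff less_one)

lemma index_smult_add_mat:
  "X \<in> carrier_mat n m \<Longrightarrow> Y \<in> carrier_mat n m \<Longrightarrow> i < n \<Longrightarrow> j < m \<Longrightarrow>
    (a \<cdot>\<^sub>m X + Y) $$ (i, j) = a * X $$ (i, j) + Y $$ (i, j)"
  by auto

text \<open>For \<open>g i = x ^ i\<close> this is \<open>(a^l - x^l) / (a - x)\<close> as a
  polynomial in \<open>a\<close>. Below, \<open>g i\<close> is the number
  \<open>L S\<^sup>i y\<close>, so that \<open>S\<close> takes the place of
  \<open>x\<close>.\<close>

definition power_quotient_poly :: "(nat \<Rightarrow> 'a :: comm_ring_1) \<Rightarrow> nat \<Rightarrow> 'a poly" where
  "power_quotient_poly g l = (\<Sum>i<l. monom (g i) (l - 1 - i))"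

lemma coeff_power_quotient_poly:
  "coeff (power_quotient_poly g l) m = (if m < l then g (l - 1 - m) else 0)"
proof -
  have "coeff (power_quotient_poly g l) m = (\<Sum>i<l. if i = l - 1 - m \<and> m < l then g i else 0)"
    unfolding power_quotient_poly_def coeff_sum coeff_monom by (intro sum.cong) auto
  also have "\<dots> = (if m < l then g (l - 1 - m) else 0)" by auto
  finally show ?thesis .
qed

lemma poly_power_quotient_poly_Suc:
  "poly (power_quotient_poly g (Suc l)) a = a * poly (power_quotient_poly g l) a + g l"
proof -
  have "(\<Sum>i<l. g i * a ^ (l - i)) = a * (\<Sum>i<l. g i * a ^ (l - 1 - i))"
    unfolding sum_distrib_left
  proof (intro sum.cong refl)
    fix i assume "i \<in> {..<l}"
    then have "l - i = Suc (l - 1 - i)" by auto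
    then show "g i * a ^ (l - i) = a * (g i * a ^ (l - 1 - i))" by (simp add: ac_simps)
  qed
  then show ?thesis by (simp add: power_quotient_poly_def poly_sum poly_monom)
qed

text \<open>The sum is \<open>p q(S) y\<close> expanded by linearity.\<close>

lemma row_pow_col_combination:
  assumes S: "S \<in> carrier_mat m m" and p: "p \<in> carrier_mat 1 m" and y: "y \<in> carrier_mat m 1"
    and q: "poly_mat q S = 0\<^sub>m m m"
  shows "(\<Sum>l\<le>degree q. coeff q l * (p * S ^\<^sub>m l * y) $$ (0, 0)) = 0"
proof -
  have Sl: "S ^\<^sub>m l \<in> carrier_mat m m" for l using S by simp
  have entry: "(\<Sum>l\<le>degree q. coeff q l * (S ^\<^sub>m l) $$ (i, j)) = 0" if "i < m" "j < m" for i j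
    using arg_cong[OF q, of "\<lambda>M. M $$ (i, j)"] that S by (simp add: poly_mat_def)
  have "(p * S ^\<^sub>m l * y) $$ (0, 0) = (\<Sum>j<m. \<Sum>i<m. p $$ (0, i) * (S ^\<^sub>m l) $$ (i, j) * y $$ (j, 0))" for l
    using sum_mat_mult[OF mult_carrier_mat[OF p Sl] y, of 0 0 l] sum_mat_mult[OF p Sl, of 0 _ l]
    by (simp add: sum_distrib_right)
  then have "(\<Sum>l\<le>degree q. coeff q l * (p * S ^\<^sub>m l * y) $$ (0, 0)) =
      (\<Sum>l\<le>degree q. \<Sum>j<m. \<Sum>i<m. p $$ (0, i) * y $$ (j, 0) * (coeff q l * (S ^\<^sub>m l) $$ (i, j)))"
    by (simp add: sum_distrib_left ac_simps)
  also have "\<dots> = (\<Sum>j<m. \<Sum>i<m. p $$ (0, i) * y $$ (j, 0) * (\<Sum>l\<le>degree q. coeff q l * (S ^\<^sub>m l) $$ (i, j)))"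
    by (simp add: sum_distrib_left sum.swap[of _ _ "{..degree q}"])
  also have "\<dots> = 0" by (simp add: entry)
  finally show ?thesis .
qed

text \<open>Iterating \<open>p S = a p + L\<close> with \<open>p y = 0\<close> gives
  \<open>p S\<^sup>l y\<close> as the quotient polynomial of the numbers
  \<open>L S\<^sup>i y\<close>, evaluated at \<open>a\<close>. Weighted by the coefficients of
  \<open>q\<close> these add up to \<open>p q(S) y = 0\<close>, so the polynomial \<open>D\<close>
  vanishes on the infinite set \<open>X\<close> and is zero. As \<open>q\<close> is monic of degree
  \<open>m\<close>, the coefficients of \<open>D\<close> form a triangular system in the
  \<open>L S\<^sup>i y\<close> with \<open>i < m\<close>; all of these vanish, and observability
  gives \<open>y = 0\<close>.\<close>

lemma shifted_rows_orthogonal_imp_zero: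
  assumes S: "S \<in> carrier_mat m m" and L: "L \<in> carrier_mat 1 m" and obs: "observable S L"
    and q: "poly_mat q S = 0\<^sub>m m m" "degree q = m" "lead_coeff q = 1"
    and y: "y \<in> carrier_mat m 1" and X: "infinite X"
    and ortho: "\<And>a. a \<in> X \<Longrightarrow> \<exists>p \<in> carrier_mat 1 m. p * S = a \<cdot>\<^sub>m p + L \<and> p * y = 0\<^sub>m 1 1"
  shows "y = 0\<^sub>m m 1"
proof -
  define g where "g i = (L * S ^\<^sub>m i * y) $$ (0, 0)" for i
  define D where "D = (\<Sum>l\<le>m. Polynomial.smult (coeff q l) (power_quotient_poly g l))"
  have Sl: "S ^\<^sub>m l \<in> carrier_mat m m" for l using S by simp
  have "poly D a = 0" if a: "a \<in> X" for a
  proof -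
    from ortho[OF a] obtain p where p: "p \<in> carrier_mat 1 m" "p * S = a \<cdot>\<^sub>m p + L" "p * y = 0\<^sub>m 1 1"
      by blast
    have "(p * S ^\<^sub>m l * y) $$ (0, 0) = poly (power_quotient_poly g l) a" for l
    proof (induction l)
      case 0
      then show ?case using p S by (simp add: power_quotient_poly_def)
    next
      case (Suc l)
      have "p * S ^\<^sub>m Suc l = p * S * S ^\<^sub>m l"
        using pow_mat_commute_self[OF S, of l] assoc_mult_mat[OF p(1) S Sl] by simp
      also have "\<dots> = a \<cdot>\<^sub>m (p * S ^\<^sub>m l) + L * S ^\<^sub>m l"
        unfolding p(2) using add_mult_distrib_mat[OF smult_carrier_mat[OF p(1)] L Sl]
          mult_smult_assoc_mat[OF p(1) Sl] by simp
      finally have eq: "p * S ^\<^sub>m Suc l * y = a \<cdot>\<^sub>m (p * S ^\<^sub>m l * y) + L * S ^\<^sub>m l * y"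
        using add_mult_distrib_mat[OF smult_carrier_mat[OF mult_carrier_mat[OF p(1) Sl]] mult_carrier_mat[OF L Sl] y]
          mult_smult_assoc_mat[OF mult_carrier_mat[OF p(1) Sl] y] by simp
      have "(p * S ^\<^sub>m Suc l * y) $$ (0, 0) = a * (p * S ^\<^sub>m l * y) $$ (0, 0) + g l"
        unfolding eq g_def
        by (rule index_smult_add_mat[OF mult_carrier_mat[OF mult_carrier_mat[OF p(1) Sl] y]
              mult_carrier_mat[OF mult_carrier_mat[OF L Sl] y]]) simp_all
      then show ?case using Suc by (simp add: poly_power_quotient_poly_Suc)
    qed
    then show ?thesis
      using row_pow_col_combination[OF S p(1) y q(1)] by (simp add: D_def poly_sum q(2))
  qed
  then have D0: "D = 0"
    using X poly_roots_finite[of D] by (metis (mono_tags, lifting) finite_subset mem_Collect_eq subsetI)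
  have g0: "i < m \<Longrightarrow> g i = 0" for i
  proof (induction i rule: less_induct)
    case (less i)
    \<comment> \<open>In this coefficient the term \<open>l = m\<close> contributes
      \<open>g i\<close>. A smaller \<open>l\<close> contributes 0 or a multiple of an earlier
      \<open>g\<close>, which is zero by induction.\<close>
    have "0 = coeff D (m - 1 - i)" using D0 by simp
    also have "\<dots> = (\<Sum>l\<le>m. if l = m then g i else 0)"
      unfolding D_def coeff_sum Polynomial.coeff_smult coeff_power_quotient_poly
    proof (intro sum.cong refl)
      fix l assume l: "l \<in> {..m}"
      show "coeff q l * (if m - 1 - i < l then g (l - 1 - (m - 1 - i)) else 0) = (if l = m then g i else 0)"
      proof (cases "l = m")
        case True
        then show ?thesis using q less.prems by auto
      next
        case False
        then have "m - 1 - i < l \<Longrightarrow> g (l - 1 - (m - 1 - i)) = 0"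
          using l less by (intro less.IH) auto
        then show ?thesis using False by simp
      qed
    qed
    also have "\<dots> = g i" by simp
    finally show ?case by simp
  qed
  show ?thesis
  proof (rule observableD[OF S L obs y])
    fix i assume "i < m"
    then show "L * S ^\<^sub>m i * y = 0\<^sub>m 1 1"
      using g0 mat_one_one_eq_zero_iff[OF mult_carrier_mat[OF mult_carrier_mat[OF L Sl] y]] by (simp add: g_def)
  qed
qed

text \<open>Take \<open>u\<close> on the moment curve \<open>(1, t, ..., t^(r-1))\<close>. Each
  product \<open>v u\<close> is then a nonzero polynomial in \<open>t\<close>, and some real
  \<open>t\<close> avoids the finitely many roots of all of them.\<close>

lemma real_vector_avoiding_kernels:
  assumes V: "finite V" "\<And>v. v \<in> V \<Longrightarrow> v \<in> carrier_mat 1 r \<and> v \<noteq> 0\<^sub>m 1 r"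
  shows "\<exists>u \<in> carrier_mat r 1. \<forall>v\<in>V. (v * cmat u) $$ (0, 0) \<noteq> 0"
proof -
  define q where "q v = (\<Sum>i<r. monom (v $$ (0, i)) i)" for v :: "complex mat"
  have coeff_q: "coeff (q v) i = (if i < r then v $$ (0, i) else 0)" for v i
    unfolding q_def coeff_sum coeff_monom by auto
  have "q v \<noteq> 0" if "v \<in> V" for v
  proof
    assume "q v = 0"
    then have "v $$ (0, i) = 0" if "i < r" for i using coeff_q[of v i] that by simp
    then have "v = 0\<^sub>m 1 r" using V(2)[OF \<open>v \<in> V\<close>] by (intro eq_matI) (auto simp: less_one)
    then show False using V(2)[OF \<open>v \<in> V\<close>] by simp
  qed
  then have "finite (\<Union>v\<in>V. complex_of_real -` {z. poly (q v) z = 0})"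
    using V(1) by (intro finite_UN_I finite_vimageI poly_roots_finite) (auto simp: inj_on_def)
  then obtain t where t: "t \<notin> (\<Union>v\<in>V. complex_of_real -` {z. poly (q v) z = 0})"
    using ex_new_if_finite[OF infinite_UNIV_char_0] by blast
  define u where "u = mat r 1 (\<lambda>(i, _). t ^ i)"
  have u: "cmat u \<in> carrier_mat r 1" by (simp add: u_def)
  have "(v * cmat u) $$ (0, 0) = poly (q v) (complex_of_real t)" if "v \<in> V" for v
    using sum_mat_mult[of v 1 r "cmat u" 1 0 0] V(2)[OF that] u
    by (simp add: q_def poly_sum poly_monom u_def)
  then show ?thesis using t by (intro bexI[of _ u]) (auto simp: u_def)
qed

lemma spectrumD:
  fixes M :: "'a :: field mat"
  assumes M: "M \<in> carrier_mat n n" and z: "z \<in> spectrum M"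
  shows "\<exists>x \<in> carrier_mat n 1. x \<noteq> 0\<^sub>m n 1 \<and> M * x = z \<cdot>\<^sub>m x"
proof -
  have C: "char_matrix M z \<in> carrier_mat n n" using M by (simp add: char_matrix_def)
  have "det (char_matrix M z) = 0" using z eigenvalue_det[OF M] by (simp add: spectrum_def)
  then obtain x where x: "x \<in> carrier_mat n 1" "x \<noteq> 0\<^sub>m n 1" "char_matrix M z * x = 0\<^sub>m n 1"
    using det_zero_imp_right_kernel[OF C] by blast
  have "char_matrix M z * x = M * x + (- z) \<cdot>\<^sub>m x"
    using M x(1) add_mult_distrib_mat[OF M smult_carrier_mat[OF one_carrier_mat] x(1)]
      mult_smult_assoc_mat[OF one_carrier_mat x(1)]
    by (simp add: char_matrix_def)
  moreover have "M * x \<in> carrier_mat n 1" by (rule mult_carrier_mat[OF M x(1)])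
  ultimately have "M * x = z \<cdot>\<^sub>m x"
    using x(1,3) unfolding mat_eq_iff by (auto simp del: index_mult_mat(1))
  then show ?thesis using x by blast
qed

text \<open>Test the expression at \<open>e = b\<close> when it is linear in \<open>e\<close>, and
  at its minimizer \<open>b / d\<close> otherwise.\<close>

lemma quadratic_nonneg_imp_zero:
  fixes b d :: real
  assumes "\<And>e. 0 \<le> e\<^sup>2 * d - 2 * e * b" and d: "d \<ge> 0"
  shows "b = 0"
proof -
  consider "d = 0" | "d > 0" using d by linarith
  then show ?thesis
  proof cases
    case 1
    then have "b\<^sup>2 \<le> 0" using assms(1)[of b] by (simp add: power2_eq_square)
    then show ?thesis by simp
  next
    case 2
    then have "(b / d)\<^sup>2 * d - 2 * (b / d) * b = - (b\<^sup>2 / d)"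
      by (simp add: field_simps power2_eq_square)
    then have "b\<^sup>2 / d \<le> 0" using assms(1)[of "b / d"] by simp
    then show ?thesis using 2 by (simp add: divide_le_0_iff)
  qed
qed

text \<open>Every \<open>v\<close> in the left kernel of \<open>P\<close> satisfies
  \<open>v G = 0\<close>, and then the Sylvester equation puts \<open>v F\<close> in the left kernel
  as well. Hence \<open>w F\<^sup>i G = 0\<close> for all \<open>i\<close>, and controllability
  gives \<open>w = 0\<close>. If \<open>v G\<close> were nonzero, the row space of \<open>P\<close>
  would contain every \<open>L S\<^sup>i\<close>, against observability and
  \<open>r < m\<close>.\<close>

lemma controllable_sylvester_left_kernel:
  assumes S: "S \<in> carrier_mat m m" and L: "L \<in> carrier_mat 1 m" and obs: "observable S L"
    and F: "F \<in> carrier_mat r r" and G: "G \<in> carrier_mat r 1" and ctr: "controllable F G"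
    and P: "P \<in> carrier_mat r m" and syl: "F * P + G * L = P * S" and rm: "r < m"
    and w: "w \<in> carrier_mat 1 r" "w * P = 0\<^sub>m 1 m"
  shows "w = 0\<^sub>m 1 r"
proof -
  have row_syl: "v * F * P + (v * G) $$ (0, 0) \<cdot>\<^sub>m L = v * P * S" if v: "v \<in> carrier_mat 1 r" for v
  proof -
    have vG: "v * G \<in> carrier_mat 1 1" using v G by simp
    have "v * G * L = (v * G) $$ (0, 0) \<cdot>\<^sub>m L"
    proof (rule eq_matI)
      fix i j assume "i < dim_row ((v * G) $$ (0, 0) \<cdot>\<^sub>m L)" "j < dim_col ((v * G) $$ (0, 0) \<cdot>\<^sub>m L)"
      then have ij: "i = 0" "j < m" using L by (auto simp: less_one)
      then show "(v * G * L) $$ (i, j) = ((v * G) $$ (0, 0) \<cdot>\<^sub>m L) $$ (i, j)"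
        using sum_mat_mult[OF vG L, of 0 j] L by (simp add: One_nat_def del: index_mult_mat(1))
    qed (use v G L in auto)
    moreover have "v * P * S = v * (F * P + G * L)"
      unfolding syl by (rule assoc_mult_mat[OF v P S])
    moreover have "\<dots> = v * F * P + v * G * L"
      using mult_add_distrib_mat[OF v mult_carrier_mat[OF F P] mult_carrier_mat[OF G L]]
        assoc_mult_mat[OF v F P] assoc_mult_mat[OF v G L] by simp
    ultimately show ?thesis by simp
  qed
  have inv: "v * G = 0\<^sub>m 1 1 \<and> v * F * P = 0\<^sub>m 1 m" if v: "v \<in> carrier_mat 1 r" and vP: "v * P = 0\<^sub>m 1 m" for v
  proof -
    define \<gamma> where "\<gamma> = (v * G) $$ (0, 0)"
    have eq: "v * F * P + \<gamma> \<cdot>\<^sub>m L = 0\<^sub>m 1 m"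
      using row_syl[OF v] S unfolding vP \<gamma>_def by simp
    have vFP: "v * F * P \<in> carrier_mat 1 m" by (rule mult_carrier_mat[OF mult_carrier_mat[OF v F] P])
    have "\<gamma> = 0"
    proof (rule ccontr)
      assume nz: "\<gamma> \<noteq> 0"
      \<comment> \<open>Solving \<open>v F P + \<gamma> L = 0\<close> for \<open>L\<close> shows
        that \<open>L\<close> is the combination of the rows of \<open>P\<close> with coefficients
        \<open>v0\<close>.\<close>
      define v0 where "v0 = (- 1 / \<gamma>) \<cdot>\<^sub>m (v * F)"
      have v0: "v0 \<in> carrier_mat 1 r" using v F by (simp add: v0_def)
      have "v0 * P = (- 1 / \<gamma>) \<cdot>\<^sub>m (v * F * P)"
        unfolding v0_def by (rule mult_smult_assoc_mat[OF mult_carrier_mat[OF v F] P])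
      also have "\<dots> = L"
      proof (rule eq_matI)
        fix i j assume ij: "i < dim_row L" "j < dim_col L"
        have "(v * F * P) $$ (i, j) + \<gamma> * L $$ (i, j) = 0"
          using arg_cong[OF eq, of "\<lambda>M. M $$ (i, j)"] ij L vFP by (simp del: index_mult_mat(1))
        then have "(v * F * P) $$ (i, j) = - \<gamma> * L $$ (i, j)" by simp
        then show "((- 1 / \<gamma>) \<cdot>\<^sub>m (v * F * P)) $$ (i, j) = L $$ (i, j)"
          using ij L v P nz by (simp del: index_mult_mat(1))
      qed (use vFP L in auto)
      finally have v0P: "v0 * P = L" .
      \<comment> \<open>The Sylvester equation together with \<open>v0 P = L\<close> makes the row
        space of \<open>P\<close> closed under right multiplication by \<open>S\<close>.\<close>
      have rows: "\<exists>x \<in> carrier_mat 1 r. L * S ^\<^sub>m i = x * P" for i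
      proof (induction i)
        case 0
        then show ?case using v0 v0P L S by (intro bexI[of _ v0]) auto
      next
        case (Suc i)
        then obtain x where x: "x \<in> carrier_mat 1 r" "L * S ^\<^sub>m i = x * P" by blast
        let ?c = "(x * G) $$ (0, 0)"
        have "L * S ^\<^sub>m Suc i = x * P * S"
          using assoc_mult_mat[OF L pow_carrier_mat[OF S] S] x(2) by (metis pow_mat.simps(2))
        also have "\<dots> = x * F * P + ?c \<cdot>\<^sub>m (v0 * P)" using row_syl[OF x(1)] v0P by simp
        also have "\<dots> = (x * F + ?c \<cdot>\<^sub>m v0) * P"
          using add_mult_distrib_mat[OF mult_carrier_mat[OF x(1) F] smult_carrier_mat[OF v0] P]
            mult_smult_assoc_mat[OF v0 P] by simp
        finally show ?case
          using add_carrier_mat[OF smult_carrier_mat[OF v0]] by blast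
      qed
      \<comment> \<open>\<open>P\<close> has more columns than rows, so some nonzero
        \<open>y\<close> is annihilated by its whole row space, in particular by every
        \<open>L S\<^sup>i\<close>.\<close>
      obtain y where y: "y \<in> carrier_mat m 1" "y \<noteq> 0\<^sub>m m 1" "P * y = 0\<^sub>m r 1"
        using wide_mat_kernel[OF P rm] by blast
      have "y = 0\<^sub>m m 1"
      proof (rule observableD[OF S L obs y(1)])
        fix i
        obtain x where x: "x \<in> carrier_mat 1 r" "L * S ^\<^sub>m i = x * P" using rows by blast
        have "x * P * y = x * (P * y)" by (rule assoc_mult_mat[OF x(1) P y(1)])
        then show "L * S ^\<^sub>m i * y = 0\<^sub>m 1 1" using x y(3) by simp
      qed
      then show False using y by simp
    qed
    then have "v * G = 0\<^sub>m 1 1"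
      using mat_one_one_eq_zero_iff[OF mult_carrier_mat[OF v G]] by (simp add: \<gamma>_def)
    moreover have "v * F * P = 0\<^sub>m 1 m"
      using eq L vFP unfolding \<open>\<gamma> = 0\<close> mat_eq_iff by (auto simp del: index_mult_mat(1))
    ultimately show ?thesis by blast
  qed
  have Fi: "F ^\<^sub>m i \<in> carrier_mat r r" for i using F by simp
  have "w * F ^\<^sub>m i * P = 0\<^sub>m 1 m" for i
  proof (induction i)
    case 0
    then show ?case using w F by simp
  next
    case (Suc i)
    have "w * F ^\<^sub>m i \<in> carrier_mat 1 r" by (rule mult_carrier_mat[OF w(1) Fi])
    from inv[OF this Suc] show ?case using assoc_mult_mat[OF w(1) Fi F] by simp
  qed
  then have "w * F ^\<^sub>m i * G = 0\<^sub>m 1 1" for i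
    using inv[OF mult_carrier_mat[OF w(1) Fi]] by blast
  then show ?thesis
    using controllableD[OF F G ctr w(1)] assoc_mult_mat[OF w(1) Fi G] by simp
qed

subsection \<open>Rank-one perturbations of a model\<close>

lemma one_by_one_mult:
  fixes X :: "'a :: comm_semiring_1 mat"
  assumes X: "X \<in> carrier_mat 1 1"
  shows mult_one_by_one_left: "Y \<in> carrier_mat 1 m \<Longrightarrow> X * Y = X $$ (0, 0) \<cdot>\<^sub>m Y"
    and mult_one_by_one_right: "Z \<in> carrier_mat n 1 \<Longrightarrow> Z * X = X $$ (0, 0) \<cdot>\<^sub>m Z"
proof -
  assume Y: "Y \<in> carrier_mat 1 m"
  show "X * Y = X $$ (0, 0) \<cdot>\<^sub>m Y"
    unfolding mat_eq_iff_entries[OF mult_carrier_mat[OF X Y] smult_carrier_mat[OF Y]]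
    using X Y sum_mat_mult[OF X Y] by (simp add: One_nat_def)
next
  assume Z: "Z \<in> carrier_mat n 1"
  show "Z * X = X $$ (0, 0) \<cdot>\<^sub>m Z"
    unfolding mat_eq_iff_entries[OF mult_carrier_mat[OF Z X] smult_carrier_mat[OF Z]]
    using X Z sum_mat_mult[OF Z X] by (simp add: One_nat_def mult.commute)
qed

text \<open>The rank-one update moves an eigenvalue of \<open>M\<close> to \<open>a\<close>: it makes \<open>u\<close> an eigenvector, and the
  characteristic polynomial becomes \<open>det (z - M) (z - a) (w (z - M)\<^sup>-\<^sup>1 u)\<close>.\<close>

lemma rank_one_update_not_spectrum:
  fixes M :: "'a :: field mat"
  assumes M: "M \<in> carrier_mat n n" and u: "u \<in> carrier_mat n 1" and w: "w \<in> carrier_mat 1 n"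
    and wu: "w * u = 1\<^sub>m 1" and z: "z \<notin> spectrum M" "z \<noteq> a"
    and nz: "(w * resolvent M z * u) $$ (0, 0) \<noteq> 0"
  shows "z \<notin> spectrum (M + (a \<cdot>\<^sub>m u - M * u) * w)"
proof
  let ?v = "a \<cdot>\<^sub>m u - M * u"
  have Mu: "M * u \<in> carrier_mat n 1" by (rule mult_carrier_mat[OF M u])
  have v: "?v \<in> carrier_mat n 1" by (rule minus_carrier_mat[OF Mu])
  have R: "resolvent M z \<in> carrier_mat n n" using M by simp
  assume "z \<in> spectrum (M + ?v * w)"
  then obtain x where x: "x \<in> carrier_mat n 1" "x \<noteq> 0\<^sub>m n 1" "(M + ?v * w) * x = z \<cdot>\<^sub>m x"
    using spectrumD[of "M + ?v * w" n z] mult_carrier_mat[OF v w] M by auto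
  define \<beta> where "\<beta> = (w * x) $$ (0, 0)"
  have wx: "w * x \<in> carrier_mat 1 1" and Mx: "M * x \<in> carrier_mat n 1"
    by (rule mult_carrier_mat[OF w x(1)], rule mult_carrier_mat[OF M x(1)])
  have "?v * w * x = \<beta> \<cdot>\<^sub>m ?v"
    unfolding assoc_mult_mat[OF v w x(1)] \<beta>_def by (rule mult_one_by_one_right[OF wx v])
  then have eq: "M * x + \<beta> \<cdot>\<^sub>m ?v = z \<cdot>\<^sub>m x"
    using add_mult_distrib_mat[OF M mult_carrier_mat[OF v w] x(1)] x(3) by simp
  \<comment> \<open>For the eigenvector \<open>x\<close> of the updated matrix,
    \<open>x - \<beta> u\<close> solves \<open>(z - M) y = (a - z) \<beta> u\<close>, and
    \<open>w y = 0\<close> because \<open>w u = 1\<close>. Applying \<open>w\<close> to the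
    resolvent form of \<open>y\<close> forces \<open>\<beta> = 0\<close>, and then \<open>x\<close>
    would be an eigenvector of \<open>M\<close> itself.\<close>
  let ?y = "x - \<beta> \<cdot>\<^sub>m u" and ?b = "((a - z) * \<beta>) \<cdot>\<^sub>m u"
  have y: "?y \<in> carrier_mat n 1" and b: "?b \<in> carrier_mat n 1" using u by auto
  have My: "M * ?y = M * x - \<beta> \<cdot>\<^sub>m (M * u)"
    using mult_minus_distrib_mat[OF M x(1) smult_carrier_mat[OF u]] mult_smult_distrib[OF M u] by simp
  have "M * ?y + ?b = z \<cdot>\<^sub>m ?y"
  proof (rule eq_matI)
    fix i j assume "i < dim_row (z \<cdot>\<^sub>m ?y)" "j < dim_col (z \<cdot>\<^sub>m ?y)"
    then have ij: "i < n" "j = 0" using u by (auto simp: less_one)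
    have "(M * x) $$ (i, 0) + \<beta> * (a * u $$ (i, 0) - (M * u) $$ (i, 0)) = z * x $$ (i, 0)"
      using arg_cong[OF eq, of "\<lambda>X. X $$ (i, 0)"] ij x(1) u M by (simp del: index_mult_mat(1))
    then show "(M * ?y + ?b) $$ (i, j) = (z \<cdot>\<^sub>m ?y) $$ (i, j)"
      unfolding My using ij x(1) u M by (simp add: algebra_simps del: index_mult_mat(1))
  qed (use M u in auto)
  then have "?y = resolvent M z * ?b" using resolvent_solves_iff[OF M z(1) y b] by simp
  then have "w * ?y = ((a - z) * \<beta>) \<cdot>\<^sub>m (w * resolvent M z * u)"
    using mult_smult_distrib[OF R u] mult_smult_distrib[OF w mult_carrier_mat[OF R u]]
      assoc_mult_mat[OF w R u] by simp
  moreover have "w * ?y = w * x - \<beta> \<cdot>\<^sub>m 1\<^sub>m 1"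
    using mult_minus_distrib_mat[OF w x(1) smult_carrier_mat[OF u]] mult_smult_distrib[OF w u] wu by simp
  ultimately have "(w * x - \<beta> \<cdot>\<^sub>m 1\<^sub>m 1) $$ (0, 0) = (((a - z) * \<beta>) \<cdot>\<^sub>m (w * resolvent M z * u)) $$ (0, 0)"
    by simp
  then have "(a - z) * \<beta> * (w * resolvent M z * u) $$ (0, 0) = 0"
    using w u x(1) by (simp add: \<beta>_def del: index_mult_mat(1))
  then have "\<beta> = 0" using z nz by simp
  moreover have "0 \<cdot>\<^sub>m X = 0\<^sub>m n 1" if "X \<in> carrier_mat n 1" for X :: "'a mat"
    using that by (auto simp: mat_eq_iff)
  ultimately have "x = resolvent M z * 0\<^sub>m n 1"
    using resolvent_solves_iff[OF M z(1) x(1), of "0\<^sub>m n 1"] eq v by simp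
  then show False using x(2) R by simp
qed

section \<open>Perturbing a minimizer whose \<open>P\<close> is rank deficient\<close>

context interpolation_data
begin

lemma disjoint_spectrum_iff:
  "spectrum (cmat S) \<inter> spectrum M = {} \<longleftrightarrow> (\<forall>i<N. s i \<notin> spectrum M)"
  by (auto simp: spectrum_S)

text \<open>Choose \<open>u\<close> with \<open>w u = 1\<close> and put \<open>P' = P + u p\<close>,
  so that \<open>w P = 0\<close> gives \<open>w P' = p\<close>. The update of \<open>F\<close> by
  \<open>v w\<close> then acts on \<open>P'\<close> as \<open>v p\<close>, and
  \<open>p S = a p + L\<close> is what balances the Sylvester equation. Adding a multiple of
  \<open>w\<close> to \<open>H\<close> changes the output row by the same multiple of
  \<open>p\<close>.\<close>

lemma feasible_perturbation:
  assumes feasible: "feasible S L r F G H P"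
    and w: "w \<in> carrier_mat 1 r" "w \<noteq> 0\<^sub>m 1 r" "w * P = 0\<^sub>m 1 \<nu>"
    and a: "complex_of_real a \<notin> spectrum (cmat S)"
    and p: "p \<in> carrier_mat 1 \<nu>" "p * S = a \<cdot>\<^sub>m p + L"
  shows "\<exists>F' G' H' P'. feasible S L r F' G' H' P' \<and> H' * P' = H * P + \<epsilon> \<cdot>\<^sub>m p"
proof -
  have F: "F \<in> carrier_mat r r" and G: "G \<in> carrier_mat r 1" and H: "H \<in> carrier_mat 1 r"
    and P: "P \<in> carrier_mat r \<nu>" and syl: "F * P + G * L = P * S"
    and disjoint: "\<forall>i<N. s i \<notin> spectrum (cmat F)"
    using feasible S by (auto simp: feasible_def is_model_def disjoint_spectrum_iff)
  have cF: "cmat F \<in> carrier_mat r r" and cw: "cmat w \<in> carrier_mat 1 r" using F w by auto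
  have R: "resolvent (cmat F) z \<in> carrier_mat r r" for z using cF by simp
  obtain u where u: "u \<in> carrier_mat r 1" and wu: "w * u = 1\<^sub>m 1"
    and nz: "\<And>i. i < N \<Longrightarrow> (cmat w * resolvent (cmat F) (s i) * cmat u) $$ (0, 0) \<noteq> 0"
  proof -
    \<comment> \<open>To keep the new spectrum away from every \<open>s i\<close>, the rank-one
      criterion asks that \<open>w R(s\<^sub>i) u\<close> be nonzero, with \<open>R\<close> the
      resolvent of \<open>F\<close>. The row \<open>w\<close> is included so that \<open>w u\<close>
      can be scaled to 1. The rows in \<open>V\<close> are nonzero because the resolvents are
      invertible.\<close>
    define V where "V = insert (cmat w) ((\<lambda>i. cmat w * resolvent (cmat F) (s i)) ` {..<N})"
    have "v \<in> carrier_mat 1 r \<and> v \<noteq> 0\<^sub>m 1 r" if v: "v \<in> V" for v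
    proof -
      have cw0: "cmat w \<noteq> 0\<^sub>m 1 r"
      proof
        assume "cmat w = 0\<^sub>m 1 r"
        moreover have "cmat (0\<^sub>m 1 r) = 0\<^sub>m 1 r" by (auto simp: mat_eq_iff)
        ultimately show False using cmat_inj[of w "0\<^sub>m 1 r"] w(2) by simp
      qed
      have "cmat w * resolvent (cmat F) (s i) \<noteq> 0\<^sub>m 1 r" if i: "i < N" for i
      proof
        let ?Z = "s i \<cdot>\<^sub>m 1\<^sub>m r - cmat F"
        have Z: "?Z \<in> carrier_mat r r" using cF by auto
        assume "cmat w * resolvent (cmat F) (s i) = 0\<^sub>m 1 r"
        then have "cmat w * (resolvent (cmat F) (s i) * ?Z) = 0\<^sub>m 1 r"
          using assoc_mult_mat[OF cw R Z, symmetric] left_mult_zero_mat[OF Z] by simp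
        then show False
          using resolvent_left[OF cF, of "s i"] disjoint i right_mult_one_mat[OF cw] cw0 by simp
      qed
      then show ?thesis using v cw cw0 mult_carrier_mat[OF cw R] by (auto simp: V_def)
    qed
    then obtain u0 where u0: "u0 \<in> carrier_mat r 1" "\<forall>v\<in>V. (v * cmat u0) $$ (0, 0) \<noteq> 0"
      using real_vector_avoiding_kernels[of V r] by (auto simp: V_def)
    define t where "t = (w * u0) $$ (0, 0)"
    have wu0: "w * u0 \<in> carrier_mat 1 1" by (rule mult_carrier_mat[OF w(1) u0(1)])
    have "(cmat w * cmat u0) $$ (0, 0) = complex_of_real t"
      unfolding cmat_mult[OF w(1) u0(1), symmetric] t_def using w(1) u0(1) by (intro index_map_mat) auto
    then have t: "t \<noteq> 0" using u0(2) by (auto simp: V_def)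
    \<comment> \<open>Rescaling achieves \<open>w u = 1\<close> and keeps the other products
      nonzero.\<close>
    define u where "u = inverse t \<cdot>\<^sub>m u0"
    have u: "u \<in> carrier_mat r 1" using u0 by (simp add: u_def)
    have "w * u = inverse t \<cdot>\<^sub>m (w * u0)"
      unfolding u_def by (rule mult_smult_distrib[OF w(1) u0(1)])
    moreover have "inverse t \<cdot>\<^sub>m X = 1\<^sub>m 1" if "X \<in> carrier_mat 1 1" "X $$ (0, 0) = t" for X
      using that t by (auto simp: mat_eq_iff less_one)
    ultimately have "w * u = 1\<^sub>m 1" using wu0 t_def by simp
    moreover have "(cmat w * resolvent (cmat F) (s i) * cmat u) $$ (0, 0) \<noteq> 0" if i: "i < N" for i
    proof -
      have cu0: "cmat u0 \<in> carrier_mat r 1" using u0 by simp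
      have "cmat u = complex_of_real (inverse t) \<cdot>\<^sub>m cmat u0"
        using u0 by (auto simp: u_def mat_eq_iff)
      then have "cmat w * resolvent (cmat F) (s i) * cmat u =
          complex_of_real (inverse t) \<cdot>\<^sub>m (cmat w * resolvent (cmat F) (s i) * cmat u0)"
        using mult_smult_distrib[OF mult_carrier_mat[OF cw R] cu0] by simp
      moreover have "(cmat w * resolvent (cmat F) (s i) * cmat u0) $$ (0, 0) \<noteq> 0"
        using u0(2) i by (auto simp: V_def)
      ultimately show ?thesis
        using t w(1) u0(1) by (simp del: index_mult_mat(1))
    qed
    ultimately show ?thesis using that u by blast
  qed
  define v where "v = a \<cdot>\<^sub>m u - F * u"
  have Fu: "F * u \<in> carrier_mat r 1" by (rule mult_carrier_mat[OF F u])
  have v: "v \<in> carrier_mat r 1" using Fu by (simp add: v_def minus_carrier_mat)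
  have vw: "v * w \<in> carrier_mat r r" by (rule mult_carrier_mat[OF v w(1)])
  have up: "u * p \<in> carrier_mat r \<nu>" by (rule mult_carrier_mat[OF u p(1)])
  \<comment> \<open>The term \<open>u p\<close> of \<open>P'\<close> already contributes
    \<open>(H u) p\<close> to the output row; \<open>\<delta>\<close> compensates for it, leaving
    \<open>\<epsilon> p\<close>.\<close>
  define \<delta> where "\<delta> = \<epsilon> - (H * u) $$ (0, 0)"
  define F' G' H' P' where "F' = F + v * w" and "G' = G + u" and "H' = H + \<delta> \<cdot>\<^sub>m w" and "P' = P + u * p"
  have carrier: "F' \<in> carrier_mat r r" "G' \<in> carrier_mat r 1" "H' \<in> carrier_mat 1 r" "P' \<in> carrier_mat r \<nu>"
    unfolding F'_def G'_def H'_def P'_def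
    by (rule add_carrier_mat[OF vw], rule add_carrier_mat[OF u],
        rule add_carrier_mat[OF smult_carrier_mat[OF w(1)]], rule add_carrier_mat[OF up])
  have wup: "w * (u * p) = p"
    using assoc_mult_mat[OF w(1) u p(1), symmetric] wu left_mult_one_mat[OF p(1)] by simp
  have wP': "w * P' = p"
    unfolding P'_def using mult_add_distrib_mat[OF w(1) P up] w(3) wup left_add_zero_mat[OF p(1)] by simp
  have "H' * P' = H * P + \<epsilon> \<cdot>\<^sub>m p"
  proof -
    have "H' * P' = H * P + H * (u * p) + \<delta> \<cdot>\<^sub>m p"
      unfolding H'_def add_mult_distrib_mat[OF H smult_carrier_mat[OF w(1)] carrier(4)]
        mult_smult_assoc_mat[OF w(1) carrier(4)] wP'
      unfolding P'_def mult_add_distrib_mat[OF H P up] ..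
    moreover have "H * (u * p) = (H * u) $$ (0, 0) \<cdot>\<^sub>m p"
      using assoc_mult_mat[OF H u p(1)] mult_one_by_one_left[OF mult_carrier_mat[OF H u] p(1)] by simp
    ultimately show ?thesis
      using H P p(1) by (auto simp: mat_eq_iff \<delta>_def algebra_simps simp del: index_mult_mat(1))
  qed
  moreover have "F' * P' + G' * L = P' * S"
  proof -
    have "F' * P' = F * P + F * (u * p) + v * p"
      unfolding F'_def add_mult_distrib_mat[OF F vw carrier(4)] assoc_mult_mat[OF v w(1) carrier(4)] wP'
      unfolding P'_def mult_add_distrib_mat[OF F P up] ..
    moreover have "v * p = a \<cdot>\<^sub>m (u * p) - F * (u * p)"
      unfolding v_def minus_mult_distrib_mat[OF smult_carrier_mat[OF u] Fu p(1)]
        mult_smult_assoc_mat[OF u p(1)] assoc_mult_mat[OF F u p(1)] ..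
    moreover have "G' * L = G * L + u * L"
      unfolding G'_def by (rule add_mult_distrib_mat[OF G u L])
    moreover have "P' * S = F * P + G * L + (a \<cdot>\<^sub>m (u * p) + u * L)"
      unfolding P'_def add_mult_distrib_mat[OF P up S] syl assoc_mult_mat[OF u p(1) S] p(2)
        mult_add_distrib_mat[OF u smult_carrier_mat[OF p(1)] L] mult_smult_distrib[OF u p(1)] ..
    ultimately show ?thesis
      using F P G L u p(1) by (auto simp: mat_eq_iff simp del: index_mult_mat(1))
  qed
  moreover have "s i \<notin> spectrum (cmat F')" if i: "i < N" for i
  proof -
    have cu: "cmat u \<in> carrier_mat r 1" using u by simp
    have "cmat v = complex_of_real a \<cdot>\<^sub>m cmat u - cmat F * cmat u"
      unfolding v_def cmat_mult[OF F u, symmetric]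
      using F u by (auto simp: mat_eq_iff simp del: index_mult_mat(1))
    then have eq: "cmat F' = cmat F + (complex_of_real a \<cdot>\<^sub>m cmat u - cmat F * cmat u) * cmat w"
      unfolding F'_def cmat_add[OF F vw] cmat_mult[OF v w(1)] by simp
    have "cmat w * cmat u = 1\<^sub>m 1"
      unfolding cmat_mult[OF w(1) u, symmetric] wu by (auto simp: mat_eq_iff)
    moreover have "s i \<noteq> complex_of_real a"
      using a i by (metis spectrum_S imageI lessThan_iff)
    ultimately show ?thesis unfolding eq
      using rank_one_update_not_spectrum[OF cF cu cw _ _ _ nz[OF i]] disjoint i by blast
  qed
  ultimately show ?thesis
    using carrier S by (auto simp: feasible_def is_model_def disjoint_spectrum_iff)
qed

text \<open>Such a \<open>p\<close> is the Sylvester solution of the one-dimensional model with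
  state matrix \<open>a\<close> and input matrix 1.\<close>

lemma shifted_row_exists:
  assumes a: "complex_of_real a \<notin> spectrum (cmat S)"
  shows "\<exists>p \<in> carrier_mat 1 \<nu>. p * S = a \<cdot>\<^sub>m p + L"
proof -
  let ?F = "a \<cdot>\<^sub>m (1\<^sub>m 1 :: real mat)"
  have cF: "cmat ?F \<in> carrier_mat 1 1" by simp
  have "z = complex_of_real a" if z: "z \<in> spectrum (cmat ?F)" for z
  proof -
    obtain x where x: "x \<in> carrier_mat 1 1" "x \<noteq> 0\<^sub>m 1 1" "cmat ?F * x = z \<cdot>\<^sub>m x"
      using spectrumD[OF cF z] by blast
    have "x $$ (0, 0) \<noteq> 0" using x(1,2) mat_one_one_eq_zero_iff by metis
    moreover have "cmat ?F * x = complex_of_real a \<cdot>\<^sub>m x"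
      using mult_one_by_one_left[OF cF x(1)] by simp
    then have "(complex_of_real a \<cdot>\<^sub>m x) $$ (0, 0) = (z \<cdot>\<^sub>m x) $$ (0, 0)" using x(3) by simp
    then have "complex_of_real a * x $$ (0, 0) = z * x $$ (0, 0)" using x(1) by simp
    ultimately show ?thesis by simp
  qed
  then have "spectrum (cmat S) \<inter> spectrum (cmat ?F) = {}" using a by blast
  then obtain p where p: "p \<in> carrier_mat 1 \<nu>" "?F * p + 1\<^sub>m 1 * L = p * S"
    using sylvester_exists[of ?F 1 "1\<^sub>m 1"] by auto
  have "?F * p = a \<cdot>\<^sub>m p"
    using mult_smult_assoc_mat[OF one_carrier_mat p(1)] left_mult_one_mat[OF p(1)] by simp
  then show ?thesis using p left_mult_one_mat[OF L] by (intro bexI[of _ p]) auto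
qed

text \<open>Along the output rows \<open>H P + e p\<close> the objective is a quadratic in
  \<open>e\<close> with its minimum at \<open>e = 0\<close>, so its linear coefficient vanishes: the
  error \<open>E\<close> is orthogonal to \<open>p\<close>. This holds for all but finitely many
  real \<open>a\<close>, so the column \<open>y\<close> that represents the inner product with
  \<open>E\<close> is zero. Testing \<open>y\<close> on \<open>E\<close> itself gives the
  claim.\<close>

lemma minimizer_rank_deficient_imp_objective_zero:
  assumes obs: "observable S L" and nd: "non_derogatory S"
    and C: "C \<in> carrier_mat 1 n" and Pi_sol: "Pi_sol \<in> carrier_mat n \<nu>"
    and sol: "is_solution C Pi_sol S L T r F G H P"
    and w: "w \<in> carrier_mat 1 r" "w \<noteq> 0\<^sub>m 1 r" "w * P = 0\<^sub>m 1 \<nu>"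
  shows "objective C Pi_sol T H P = 0"
proof -
  have feasible: "feasible S L r F G H P"
    and minimal: "\<And>F' G' H' P'. feasible S L r F' G' H' P' \<Longrightarrow>
      objective C Pi_sol T H P \<le> objective C Pi_sol T H' P'"
    using sol by (auto simp: is_solution_def)
  have H: "H \<in> carrier_mat 1 r" and P: "P \<in> carrier_mat r \<nu>"
    using feasible S by (auto simp: feasible_def is_model_def)
  define E where "E = C * Pi_sol - H * P"
  have HP: "H * P \<in> carrier_mat 1 \<nu>" by (rule mult_carrier_mat[OF H P])
  have E: "E \<in> carrier_mat 1 \<nu>" unfolding E_def by (rule minus_carrier_mat[OF HP])
  define x where "x e c = (cmat e * T) $$ (0, c)" for e c
  have x_sum: "x e c = (\<Sum>i<\<nu>. complex_of_real (e $$ (0, i)) * T $$ (i, c))"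
    if "e \<in> carrier_mat 1 \<nu>" "c < \<nu>" for e c
    using sum_mat_mult[of "cmat e" 1 \<nu> T \<nu> 0 c] that T by (simp add: x_def)
  have obj: "objective C Pi_sol T H P = (\<Sum>c<\<nu>. (cmod (x E c))\<^sup>2)"
    using objective_eq_sum[OF E[unfolded E_def]] by (simp add: E_def x_def)
  define h where "h i c = Re (cnj (x E c) * T $$ (i, c))" for i c
  \<comment> \<open>\<open>y\<close> represents, as a real column, the functional sending
    \<open>e\<close> to the real part of the Hermitian product of \<open>E T\<close> and
    \<open>e T\<close>. Being real, it can be tested against the observability of
    \<open>(S, L)\<close>.\<close>
  define y where "y = mat \<nu> 1 (\<lambda>(i, _). \<Sum>c<\<nu>. h i c)"
  have y: "y \<in> carrier_mat \<nu> 1" by (simp add: y_def)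
  have bilinear: "(e * y) $$ (0, 0) = (\<Sum>c<\<nu>. Re (cnj (x E c) * x e c))"
    if e: "e \<in> carrier_mat 1 \<nu>" for e
  proof -
    have "(e * y) $$ (0, 0) = (\<Sum>i<\<nu>. \<Sum>c<\<nu>. e $$ (0, i) * h i c)"
      using sum_mat_mult[OF e y, of 0 0] by (simp add: y_def sum_distrib_left)
    also have "\<dots> = (\<Sum>c<\<nu>. \<Sum>i<\<nu>. e $$ (0, i) * h i c)"
      by (rule sum.swap)
    also have "\<dots> = (\<Sum>c<\<nu>. Re (cnj (x E c) * x e c))"
    proof (intro sum.cong refl)
      fix c assume "c \<in> {..<\<nu>}"
      then have "cnj (x E c) * x e c = (\<Sum>i<\<nu>. complex_of_real (e $$ (0, i)) * (cnj (x E c) * T $$ (i, c)))"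
        using x_sum[OF e, of c] by (simp add: sum_distrib_left mult.left_commute)
      moreover have "Re (complex_of_real a * z) = a * Re z" for a z by simp
      ultimately show "(\<Sum>i<\<nu>. e $$ (0, i) * h i c) = Re (cnj (x E c) * x e c)"
        by (simp only: h_def Re_sum )
    qed
    finally show ?thesis .
  qed
  have ortho: "\<exists>p \<in> carrier_mat 1 \<nu>. p * S = a \<cdot>\<^sub>m p + L \<and> p * y = 0\<^sub>m 1 1"
    if a: "complex_of_real a \<notin> spectrum (cmat S)" for a
  proof -
    obtain p where p: "p \<in> carrier_mat 1 \<nu>" "p * S = a \<cdot>\<^sub>m p + L" using shifted_row_exists[OF a] by blast
    define b where "b = (p * y) $$ (0, 0)"
    define d where "d = (\<Sum>c<\<nu>. (cmod (x p c))\<^sup>2)"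
    have "0 \<le> e\<^sup>2 * d - 2 * e * b" for e
    proof -
      obtain F' G' H' P' where f: "feasible S L r F' G' H' P'" and HP': "H' * P' = H * P + e \<cdot>\<^sub>m p"
        using feasible_perturbation[OF feasible w a p, of e] by blast
      have ep: "E - e \<cdot>\<^sub>m p \<in> carrier_mat 1 \<nu>" by (rule minus_carrier_mat[OF smult_carrier_mat[OF p(1)]])
      have E': "C * Pi_sol - H' * P' = E - e \<cdot>\<^sub>m p"
        unfolding HP' E_def using C Pi_sol H P p(1) by (auto simp: mat_eq_iff simp del: index_mult_mat(1))
      have "x (E - e \<cdot>\<^sub>m p) c = x E c - complex_of_real e * x p c" if c: "c < \<nu>" for c
      proof -
        have "x (E - e \<cdot>\<^sub>m p) c =
            (\<Sum>i<\<nu>. complex_of_real (E $$ (0, i)) * T $$ (i, c) -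
              complex_of_real e * (complex_of_real (p $$ (0, i)) * T $$ (i, c)))"
          unfolding x_sum[OF ep c] using E p(1) by (intro sum.cong) (auto simp: algebra_simps)
        then show ?thesis unfolding x_sum[OF E c] x_sum[OF p(1) c]
          by (simp add: sum_subtractf sum_distrib_left)
      qed
      moreover have "(cmod (\<alpha> - complex_of_real e * \<beta>))\<^sup>2 =
          (cmod \<alpha>)\<^sup>2 - 2 * e * Re (cnj \<alpha> * \<beta>) + e\<^sup>2 * (cmod \<beta>)\<^sup>2" for \<alpha> \<beta>
        unfolding cmod_power2 by (simp add: power2_eq_square algebra_simps)
      ultimately have "objective C Pi_sol T H' P' =
          (\<Sum>c<\<nu>. (cmod (x E c))\<^sup>2 - 2 * e * Re (cnj (x E c) * x p c) + e\<^sup>2 * (cmod (x p c))\<^sup>2)"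
        using objective_eq_sum[OF ep[folded E'], unfolded E'] by (simp add: x_def)
      also have "\<dots> = objective C Pi_sol T H P - 2 * e * b + e\<^sup>2 * d"
        unfolding b_def bilinear[OF p(1)] d_def obj
        by (simp only: sum.distrib sum_subtractf sum_distrib_left)
      finally show ?thesis using minimal[OF f] by simp
    qed
    then have "b = 0" by (rule quadratic_nonneg_imp_zero) (simp add: d_def sum_nonneg)
    then have "p * y = 0\<^sub>m 1 1"
      using mat_one_one_eq_zero_iff[OF mult_carrier_mat[OF p(1) y]] by (simp add: b_def)
    then show ?thesis using p by blast
  qed
  have cS: "cmat S \<in> carrier_mat \<nu> \<nu>" using S by simp
  have "finite (complex_of_real -` spectrum (cmat S))"
    using card_finite_spectrum(1)[OF cS] by (intro finite_vimageI) (auto simp: inj_on_def)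
  then have inf: "infinite (- (complex_of_real -` spectrum (cmat S)))"
    by (simp add: infinite_UNIV_char_0 Compl_eq_Diff_UNIV Diff_infinite_finite)
  \<comment> \<open>The characteristic polynomial is monic of degree \<open>\<nu>\<close> and
    annihilates \<open>S\<close>, so it can serve as \<open>q\<close> in the orthogonality
    lemma.\<close>
  have "poly_mat (char_poly S) S = 0\<^sub>m \<nu> \<nu>"
    using nd S by (simp add: non_derogatory_def is_minimal_polynomial_def)
  then have "y = 0\<^sub>m \<nu> 1"
    using shifted_rows_orthogonal_imp_zero[OF S L obs _ _ _ y inf] degree_monic_char_poly[OF S] ortho
    by auto
  then have "(E * y) $$ (0, 0) = 0" using right_mult_zero_mat[OF E] by simp
  moreover have "Re (cnj z * z) = (cmod z)\<^sup>2" for z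
    by (subst cmod_power2) (simp add: power2_eq_square)
  ultimately show ?thesis unfolding obj bilinear[OF E] by (simp only:)
qed

end

text \<open>Every admissible model extends to a feasible tuple by a Sylvester solution, and the two
  costs agree on feasible tuples. Both minimizations therefore run over the same models with the
  same values.\<close>

lemma is_solution_iff_least_squares:
  assumes "interpolation_data S L T \<nu> N s k"
    and A: "A \<in> carrier_mat n n" and B: "B \<in> carrier_mat n 1" and C: "C \<in> carrier_mat 1 n"
    and Pi_sol: "Pi_sol \<in> carrier_mat n \<nu>" "A * Pi_sol + B * L = Pi_sol * S"
    and disjoint: "spectrum (cmat S) \<inter> spectrum (cmat A) = {}"
    and feasible: "feasible S L r F G H P"
  shows "is_solution C Pi_sol S L T r F G H P \<longleftrightarrow> least_squares_moment_matching A B C N s k r F G H"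
proof -
  interpret interpolation_data S L T \<nu> N s k by fact
  have index: "objective C Pi_sol T H' P' = matching_index A B C N s k F' G' H'"
    if "feasible S L r F' G' H' P'" for F' G' H' P'
    by (rule objective_eq_matching_index[OF A B C Pi_sol disjoint that])
  have "(\<exists>P'. feasible S L r F' G' H' P') \<longleftrightarrow> is_model r F' G' H' \<and> moments_well_defined N s F'" for F' G' H'
    using sylvester_exists[of F' r G'] S
    by (auto simp: feasible_def is_model_def moments_well_defined_iff)
  then show ?thesis
    using feasible index unfolding is_solution_def least_squares_moment_matching_def by metis
qed

(* exact_case only concerns models that match all moments exactly, and for these it excludes
   precisely the counterexamples. If r \<ge> 1 and all moments of W at the points s i vanish, e.g.
   W(s) = s (s^2 + 1) / (s + 1)^4 at 0, i, -i with r = 1, then F = -1, G = 0, H = 0 has index 0, but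
   F P = P S forces P = 0, which does not have full rank. *)

theorem theorem2:
  fixes A B C F G H S L Pi_sol :: "real mat" and T :: "complex mat"
    and n r \<nu> N :: nat and s :: "nat \<Rightarrow> complex" and k :: "nat \<Rightarrow> nat"
  assumes A: "A \<in> carrier_mat n n" and B: "B \<in> carrier_mat n 1" and C: "C \<in> carrier_mat 1 n"
    and minimal: "controllable A B" "observable A C"
    and model: "is_model r F G H"
    and S: "S \<in> carrier_mat \<nu> \<nu>" and non_derogatory: "non_derogatory S"
    and distinct_points: "inj_on s {..<N}"
    and \<nu>: "\<nu> = (\<Sum>i<N. (k i + 1))"
    and char_poly_S: "char_poly (cmat S) = (\<Prod>i<N. [:- s i, 1:] ^ (k i + 1))"
    and order: "2 * r < \<nu>"
    and L: "L \<in> carrier_mat 1 \<nu>" and observable_SL: "observable S L"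
    and T: "T \<in> carrier_mat \<nu> \<nu>" "invertible_mat T"
    and ST: "cmat S * T = T * jordan_form N s k"
    and LT: "cmat L * T = Lambda_row N k"
    and disjoint: "spectrum (cmat S) \<inter> spectrum (cmat A) = {}"
    and Pi_sol: "Pi_sol \<in> carrier_mat n \<nu>" and sylvester: "A * Pi_sol + B * L = Pi_sol * S"
    and exact_case: "moments_well_defined N s F \<Longrightarrow> matching_index A B C N s k F G H = 0 \<Longrightarrow>
          controllable F G"
  shows "least_squares_moment_matching A B C N s k r F G H \<longleftrightarrow>
    (\<exists>P \<in> carrier_mat r \<nu>. full_rank P \<and> is_solution C Pi_sol S L T r F G H P)"
proof -
  interpret interpolation_data S L T \<nu> N s k
    by unfold_locales fact+
  note iff = is_solution_iff_least_squares[OF interpolation_data_axioms A B C Pi_sol sylvester disjoint]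
  show ?thesis
  proof
    assume lsq: "least_squares_moment_matching A B C N s k r F G H"
    have F: "F \<in> carrier_mat r r" and G: "G \<in> carrier_mat r 1"
      using model by (auto simp: is_model_def)
    have mwd: "moments_well_defined N s F"
      using lsq by (simp add: least_squares_moment_matching_def)
    then obtain P where P: "P \<in> carrier_mat r \<nu>" and syl: "F * P + G * L = P * S"
      using sylvester_exists[OF F G] by (auto simp: moments_well_defined_iff)
    have feasible: "feasible S L r F G H P"
      using model P syl mwd S by (simp add: feasible_def moments_well_defined_iff)
    have sol: "is_solution C Pi_sol S L T r F G H P" using iff[OF feasible] lsq by simp
    have "full_rank P"
    proof (rule ccontr)
      assume "\<not> full_rank P"
      \<comment> \<open>The order bound gives \<open>r \<le> \<nu>\<close>, so failure of full rank
        means that the rows of \<open>P\<close> are dependent.\<close>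
      then obtain w where w: "w \<in> carrier_mat 1 r" "w \<noteq> 0\<^sub>m 1 r" "w * P = 0\<^sub>m 1 \<nu>"
        using not_full_rank_imp_left_kernel[OF P] order by auto
      have "objective C Pi_sol T H P = 0"
        by (rule minimizer_rank_deficient_imp_objective_zero[OF observable_SL non_derogatory C Pi_sol sol w])
      \<comment> \<open>A zero objective means that every moment is matched, which is the situation
        of \<open>exact_case\<close>. The controllability it supplies is incompatible with a nonzero
        \<open>w\<close> in the left kernel of \<open>P\<close>.\<close>
      then have "controllable F G"
        using objective_eq_matching_index[OF A B C Pi_sol sylvester disjoint feasible] exact_case[OF mwd]
        by simp
      then show False
        using controllable_sylvester_left_kernel[OF S L observable_SL F G _ P syl _ w(1,3)] order w(2)
        by simp
    qed
    with P sol show "\<exists>P \<in> carrier_mat r \<nu>. full_rank P \<and> is_solution C Pi_sol S L T r F G H P"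
      by blast
  next
    assume "\<exists>P \<in> carrier_mat r \<nu>. full_rank P \<and> is_solution C Pi_sol S L T r F G H P"
    then obtain P where "is_solution C Pi_sol S L T r F G H P" by blast
    then show "least_squares_moment_matching A B C N s k r F G H"
      using iff[of r F G H P] by (simp add: is_solution_def)
  qed
qed

end
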